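(* Let $\mu$ be a positive measure supported in $\mathbb T$, with deformation $\mu(t)$, let $\vec n=(n_+,n_-)$ with integers $n_\pm\ge1$, and let $l\ge|\vec n|=n_++n_-$. 1. The second kind functions have the representations $$\overline{C_{1,1}^{(l)}(z,t)}=\bar z^{-\nu_+(l_{+1})}\frac{\tau_{1,+1}^{(l+1)}(t+[\bar z^{-1}]_1)}{\tau^{(l+1)}(t)}\ \ (R_-<|z|),\qquad\overline{C_{1,2}^{(l)}(z,t)}=\bar z^{\nu_-(l_{+2})-1}\frac{\tau_{1,+2}^{(l+1)}(t-[\bar z]_2)}{\tau^{(l+1)}(t)}\ \ (|z|<R_+),$$ $$\overline{C_1^{(l)}(z,t)}=\frac{\bar z^{-\nu_+(l_{+1})}\tau_{1,+1}^{(l+1)}(t+[\bar z^{-1}]_1)+\bar z^{\nu_-(l_{+2})-1}\tau_{1,+2}^{(l+1)}(t-[\bar z]_2)}{\tau^{(l+1)}(t)}\ \ (R_-<|z|<R_+),$$ $$C_{2,1}^{(l)}(z,t)=z^{-\nu_+(l_{+1})}\frac{\tau_{2,+1}^{(l+1)}(t-[z^{-1}]_2)}{\tau^{(l)}(t)}\ \ (R_+^{-1}<|z|),\qquad C_{2,2}^{(l)}(z,t)=z^{\nu_-(l_{+2})-1}\frac{\tau_{2,+2}^{(l+1)}(t+[z]_1)}{\tau^{(l)}(t)}\ \ (|z|<R_-^{-1}),$$ $$C_2^{(l)}(z,t)=\frac{z^{-\nu_+(l_{+1})}\tau_{2,+1}^{(l+1)}(t-[z^{-1}]_2)+z^{\nu_-(l_{+2})-1}\tau_{2,+2}^{(l+1)}(t+[z]_1)}{\tau^{(l)}(t)}\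 \ (R_+^{-1}<|z|<R_-^{-1}).$$ 2. For $R_-<|z|<R_+$ (wherever the denominators do not vanish) the Fourier series of the measure satisfies, with $N:=\nu_+(l_{+1})+\nu_-(l_{+2})-1$, if $a(l)=1$: $$F_{\mu(t)}(z)=\frac{\tau_{2,+1}^{(l+1)}(t-[z]_2)+z^{-N}\tau_{2,+2}^{(l+1)}(t+[z^{-1}]_1)}{2\pi\,\tau^{(l)}(t-[z^{-1}]_1)}=\frac{\tau_{1,+1}^{(l+1)}(t+[z^{-1}]_1)+z^{N}\tau_{1,+2}^{(l+1)}(t-[z]_2)}{2\pi\,\tau^{(l)}(t+[z]_2)},$$ and if $a(l)=2$: $$F_{\mu(t)}(z)=\frac{z^{N}\tau_{2,+1}^{(l+1)}(t-[z]_2)+\tau_{2,+2}^{(l+1)}(t+[z^{-1}]_1)}{2\pi\,\tau^{(l)}(t+[z]_2)}=\frac{z^{-N}\tau_{1,+1}^{(l+1)}(t+[z^{-1}]_1)+\tau_{1,+2}^{(l+1)}(t-[z]_2)}{2\pi\,\tau^{(l)}(t-[z^{-1}]_1)}.$$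
   Context: $\mathbb T$ is the unit circle; $\dagger$ is the conjugate transpose; indices start at $0$. Deformed measure: $d\mu(t,u)=\exp\big(\sum_{j\ge1}(t_{1j}u^j-t_{2j}u^{-j})\big)d\mu(u)$, with complex parameters $t$ such that $\sum_jt_{aj}u^j$ converges for all $u$ and $\mu(t)$ is quasi-definite (all Toeplitz moment matrices $\big(\oint_{\mathbb T}u^{i-j}d\mu(t,u)\big)_{i,j=0}^n$ non-singular). Extended ordering: $\chi=\chi_{\vec n}=(1,z,\dots,z^{n_+-1},z^{-1},\dots,z^{-n_-},z^{n_+},\dots,z^{2n_+-1},z^{-n_--1},\dots,z^{-2n_-},\dots)^\top$. $a(l)=1$ if $\chi^{(l)}$ is a non-negative power of $z$, $a(l)=2$ otherwise. $\nu_+(l)$ (resp. $\nu_-(l)$) is the number of $0\le l'\le l$ with $a(l')=1$ (resp. $2$). $l_{+a}$ is the smallest $l'\ge l$ with $a(l')=a$. $\chi_1(z)$ is the vector with $l$-th entry $z^{\nu_+(l)-1}$ if $a(l)=1$ and $0$ otherwise; $\chi_2(z)$ the vector with $l$-th entry $z^{\nu_-(l)-1}$ if $a(l)=2$ and $0$ otherwise; $\chi_a^*(z)=z^{-1}\chi_a(z^{-1})$; $\chi=\chi_1+\chi_2^*$. $g(t)=\oint_{\mathbb T}\chi\chi^\dagger d\mu(t)=S_1(t)^{-1}S_2(t)$ with $S_1$ lower unitriangular, $S_2$ upper triangular. Second kind functions: $C_{1,1}=(S_1^{-1})^\dagger\chi_1^*$, $C_{1,2}=(S_1^{-1})^\dagger\chi_2$,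 $C_{2,1}=S_2\chi_1^*$, $C_{2,2}=S_2\chi_2$, $C_1=C_{1,1}+C_{1,2}$, $C_2=C_{2,1}+C_{2,2}$ (components of convergent series). $\tau$-functions: $\tau^{(l)}(t)=\det g^{[l]}(t)$ (leading $l\times l$ minor); $\tau_{2,+a}^{(l+1)}(t)$ is the minor of $g(t)$ with rows $0,\dots,l$ and columns $0,\dots,l-1,l_{+a}$ (in this order); $\tau_{1,+a}^{(l+1)}(t)$ is the minor with rows $0,\dots,l-1,l_{+a}$ (in this order) and columns $0,\dots,l$. $F_{\mu(t)}(z)=\sum_{n\in\mathbb Z}c_n(t)z^n$, $c_n(t)=\frac1{2\pi}\int_0^{2\pi}e^{-in\theta}d\mu(t,\theta)$; $R_+=(\limsup_{n\to\infty}|c_n|^{1/n})^{-1}$, $R_-=\limsup_{n\to\infty}|c_{-n}|^{1/n}$ where $c_n$ are the Fourier coefficients of $\mu$ (the same radii are obtained from $\mu(t)$). Miwa shifts: $t\pm[w]_1$ is $t_{1j}\mapsto t_{1j}\pm w^j/j$, $t\pm[w]_2$ is $t_{2j}\mapsto t_{2j}\pm w^j/j$. For $|w|<1$ they amount to replacing $d\mu(t,u)$ by $(1-wu)^{\mp1}d\mu(t,u)$ and $(1-w/u)^{\pm1}d\mu(t,u)$ respectively in the determinants. For $|w|\ge1$ the shifted $\tau$-functions denote the analytic (or polynomial) continuation in $w$ of the functions so obtained for $|w|<1$, to the regions stated. *)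

theory Defs
  imports "HOL-Analysis.Analysis" "Jordan_Normal_Form.Determinant"
begin

text \<open>
  A finite positive measure supported in the unit circle is a Borel measure \<open>M\<close> on \<open>complex\<close> for
  which the complement of the circle is null. With \<open>u = exp(i \<theta>)\<close>, the integral of \<open>f(u)\<close> against
  \<open>d\<mu>(\<theta>)\<close> over \<open>[0, 2\<pi>]\<close> is the integral of \<open>f\<close> against \<open>M\<close>, without a normalising factor
  \<open>1/(2\<pi>)\<close>.
\<close>

definition circle_measure :: "complex measure \<Rightarrow> bool" where
  "circle_measure M \<longleftrightarrow>
     finite_measure M \<and> sets M = sets borel \<and> emeasure M (- sphere 0 1) = 0"


subsection \<open>The deformed measure\<close>

text \<open>
  Deformation parameters are functions \<open>t :: nat \<Rightarrow> nat \<Rightarrow> complex\<close>, with \<open>t a j\<close> for \<open>a = 1, 2\<close> and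
  \<open>j \<ge> 1\<close>; all other values of \<open>t\<close> are irrelevant. The deformed measure is in general a complex
  measure and is represented by its integration functional.
\<close>

definition entire_parameters :: "(nat \<Rightarrow> nat \<Rightarrow> complex) \<Rightarrow> bool" where
  "entire_parameters t \<longleftrightarrow>
     (\<forall>a\<in>{1, 2}. \<forall>u::complex. summable (\<lambda>j. t a (Suc j) * u ^ Suc j))"

definition potential :: "(nat \<Rightarrow> nat \<Rightarrow> complex) \<Rightarrow> complex \<Rightarrow> complex" where
  "potential t u =
     (\<Sum>j. t 1 (Suc j) * u powi int (Suc j) - t 2 (Suc j) * u powi (- int (Suc j)))"

definition circle_integral ::
    "complex measure \<Rightarrow> (nat \<Rightarrow> nat \<Rightarrow> complex) \<Rightarrow> (complex \<Rightarrow> complex) \<Rightarrow> complex" where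
  "circle_integral M t f = (LINT u|M. f u * exp (potential t u))"

definition toeplitz_moment_matrix ::
    "complex measure \<Rightarrow> (nat \<Rightarrow> nat \<Rightarrow> complex) \<Rightarrow> nat \<Rightarrow> complex mat" where
  "toeplitz_moment_matrix M t n =
     Matrix.mat (Suc n) (Suc n) (\<lambda>(i, j). circle_integral M t (\<lambda>u. u powi (int i - int j)))"

definition quasi_definite :: "complex measure \<Rightarrow> (nat \<Rightarrow> nat \<Rightarrow> complex) \<Rightarrow> bool" where
  "quasi_definite M t \<longleftrightarrow> (\<forall>n. Determinant.det (toeplitz_moment_matrix M t n) \<noteq> 0)"

definition fourier_coeff ::
    "complex measure \<Rightarrow> (nat \<Rightarrow> nat \<Rightarrow> complex) \<Rightarrow> int \<Rightarrow> complex" where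
  "fourier_coeff M t n = 1 / (2 * of_real pi) * circle_integral M t (\<lambda>u. u powi (- n))"

definition fourier_series ::
    "complex measure \<Rightarrow> (nat \<Rightarrow> nat \<Rightarrow> complex) \<Rightarrow> complex \<Rightarrow> complex" where
  "fourier_series M t z = (\<Sum>\<^sub>\<infinity>n\<in>UNIV. fourier_coeff M t n * z powi n)"

text \<open>
  The radii belong to the undeformed measure, \<open>t = 0\<close>. In \<open>ereal\<close> one has \<open>inverse 0 = \<infinity>\<close> and
  \<open>inverse \<infinity> = 0\<close>.
\<close>

definition R_plus :: "complex measure \<Rightarrow> ereal" where
  "R_plus M = inverse (limsup (\<lambda>n. ereal (root n (norm (fourier_coeff M (\<lambda>_ _. 0) (int n))))))"

definition R_minus :: "complex measure \<Rightarrow> ereal" where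
  "R_minus M = limsup (\<lambda>n. ereal (root n (norm (fourier_coeff M (\<lambda>_ _. 0) (- int n)))))"


subsection \<open>The extended ordering\<close>

text \<open>
  The pair \<open>nv = (n\<^sub>+, n\<^sub>-)\<close> fixes the ordering. Block \<open>q\<close> of \<open>\<chi>\<close> consists of the powers
  \<open>q n\<^sub>+, \<dots>, (q + 1) n\<^sub>+ - 1\<close> followed by \<open>-(q n\<^sub>- + 1), \<dots>, -(q + 1) n\<^sub>-\<close>.
\<close>

definition chi_exp :: "nat \<times> nat \<Rightarrow> nat \<Rightarrow> int" where
  "chi_exp nv l =
     (let q = l div (fst nv + snd nv); r = l mod (fst nv + snd nv)
      in if r < fst nv then int (q * fst nv + r)
         else - int (q * snd nv + (r - fst nv) + 1))"

definition chi :: "nat \<times> nat \<Rightarrow> complex \<Rightarrow> nat \<Rightarrow> complex" where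
  "chi nv z l = z powi chi_exp nv l"

definition ind_a :: "nat \<times> nat \<Rightarrow> nat \<Rightarrow> nat" where
  "ind_a nv l = (if chi_exp nv l \<ge> 0 then 1 else 2)"

definition nu_plus :: "nat \<times> nat \<Rightarrow> nat \<Rightarrow> nat" where
  "nu_plus nv l = card {l'. l' \<le> l \<and> ind_a nv l' = 1}"

definition nu_minus :: "nat \<times> nat \<Rightarrow> nat \<Rightarrow> nat" where
  "nu_minus nv l = card {l'. l' \<le> l \<and> ind_a nv l' = 2}"

definition next_ind :: "nat \<times> nat \<Rightarrow> nat \<Rightarrow> nat \<Rightarrow> nat" where
  "next_ind nv a l = (LEAST l'. l \<le> l' \<and> ind_a nv l' = a)"

definition chi1 :: "nat \<times> nat \<Rightarrow> complex \<Rightarrow> nat \<Rightarrow> complex" where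
  "chi1 nv z l = (if ind_a nv l = 1 then z powi (int (nu_plus nv l) - 1) else 0)"

definition chi2 :: "nat \<times> nat \<Rightarrow> complex \<Rightarrow> nat \<Rightarrow> complex" where
  "chi2 nv z l = (if ind_a nv l = 2 then z powi (int (nu_minus nv l) - 1) else 0)"

definition chi1_star :: "nat \<times> nat \<Rightarrow> complex \<Rightarrow> nat \<Rightarrow> complex" where
  "chi1_star nv z l = inverse z * chi1 nv (inverse z) l"


subsection \<open>Moment matrix and Gauss--Borel factorisation\<close>

definition moment_matrix ::
    "complex measure \<Rightarrow> nat \<times> nat \<Rightarrow> (nat \<Rightarrow> nat \<Rightarrow> complex) \<Rightarrow> nat \<Rightarrow> nat \<Rightarrow> complex" where
  "moment_matrix M nv t i j = circle_integral M t (\<lambda>u. chi nv u i * cnj (chi nv u j))"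

definition smat_mult ::
    "(nat \<Rightarrow> nat \<Rightarrow> complex) \<Rightarrow> (nat \<Rightarrow> nat \<Rightarrow> complex) \<Rightarrow> nat \<Rightarrow> nat \<Rightarrow> complex" where
  "smat_mult A B i j = (\<Sum>k. A i k * B k j)"

definition smat_adjoint :: "(nat \<Rightarrow> nat \<Rightarrow> complex) \<Rightarrow> nat \<Rightarrow> nat \<Rightarrow> complex" where
  "smat_adjoint A i j = cnj (A j i)"

definition lower_unitriangular :: "(nat \<Rightarrow> nat \<Rightarrow> complex) \<Rightarrow> bool" where
  "lower_unitriangular A \<longleftrightarrow> (\<forall>i. A i i = 1) \<and> (\<forall>i j. i < j \<longrightarrow> A i j = 0)"

definition upper_triangular_smat :: "(nat \<Rightarrow> nat \<Rightarrow> complex) \<Rightarrow> bool" where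
  "upper_triangular_smat A \<longleftrightarrow> (\<forall>i j. j < i \<longrightarrow> A i j = 0)"

definition lower_inverse :: "(nat \<Rightarrow> nat \<Rightarrow> complex) \<Rightarrow> nat \<Rightarrow> nat \<Rightarrow> complex" where
  "lower_inverse A =
     (THE B. lower_unitriangular B \<and>
             smat_mult A B = (\<lambda>i j. if i = j then 1 else 0) \<and>
             smat_mult B A = (\<lambda>i j. if i = j then 1 else 0))"

definition gauss_borel ::
    "(nat \<Rightarrow> nat \<Rightarrow> complex) \<Rightarrow> (nat \<Rightarrow> nat \<Rightarrow> complex) \<times> (nat \<Rightarrow> nat \<Rightarrow> complex)" where
  "gauss_borel g =
     (THE (S1, S2). lower_unitriangular S1 \<and> upper_triangular_smat S2 \<and>
                    g = smat_mult (lower_inverse S1) S2)"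

definition S1 ::
    "complex measure \<Rightarrow> nat \<times> nat \<Rightarrow> (nat \<Rightarrow> nat \<Rightarrow> complex) \<Rightarrow> nat \<Rightarrow> nat \<Rightarrow> complex" where
  "S1 M nv t = fst (gauss_borel (moment_matrix M nv t))"

definition S2 ::
    "complex measure \<Rightarrow> nat \<times> nat \<Rightarrow> (nat \<Rightarrow> nat \<Rightarrow> complex) \<Rightarrow> nat \<Rightarrow> nat \<Rightarrow> complex" where
  "S2 M nv t = snd (gauss_borel (moment_matrix M nv t))"


subsection \<open>Second kind functions\<close>

text \<open>
  \<open>C11_term M nv t z l\<close> is the sequence of terms of the series that is the \<open>l\<close>-th component of
  \<open>C\<^sub>1\<^sub>,\<^sub>1(z, t)\<close>, and similarly for the other three.
\<close>

definition C11_term ::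
    "complex measure \<Rightarrow> nat \<times> nat \<Rightarrow> (nat \<Rightarrow> nat \<Rightarrow> complex) \<Rightarrow> complex \<Rightarrow> nat \<Rightarrow> nat \<Rightarrow> complex"
  where "C11_term M nv t z l k =
           smat_adjoint (lower_inverse (S1 M nv t)) l k * chi1_star nv z k"

definition C12_term ::
    "complex measure \<Rightarrow> nat \<times> nat \<Rightarrow> (nat \<Rightarrow> nat \<Rightarrow> complex) \<Rightarrow> complex \<Rightarrow> nat \<Rightarrow> nat \<Rightarrow> complex"
  where "C12_term M nv t z l k =
           smat_adjoint (lower_inverse (S1 M nv t)) l k * chi2 nv z k"

definition C21_term ::
    "complex measure \<Rightarrow> nat \<times> nat \<Rightarrow> (nat \<Rightarrow> nat \<Rightarrow> complex) \<Rightarrow> complex \<Rightarrow> nat \<Rightarrow> nat \<Rightarrow> complex"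
  where "C21_term M nv t z l k = S2 M nv t l k * chi1_star nv z k"

definition C22_term ::
    "complex measure \<Rightarrow> nat \<times> nat \<Rightarrow> (nat \<Rightarrow> nat \<Rightarrow> complex) \<Rightarrow> complex \<Rightarrow> nat \<Rightarrow> nat \<Rightarrow> complex"
  where "C22_term M nv t z l k = S2 M nv t l k * chi2 nv z k"

definition C11 ::
    "complex measure \<Rightarrow> nat \<times> nat \<Rightarrow> (nat \<Rightarrow> nat \<Rightarrow> complex) \<Rightarrow> complex \<Rightarrow> nat \<Rightarrow> complex" where
  "C11 M nv t z l = (\<Sum>k. C11_term M nv t z l k)"

definition C12 ::
    "complex measure \<Rightarrow> nat \<times> nat \<Rightarrow> (nat \<Rightarrow> nat \<Rightarrow> complex) \<Rightarrow> complex \<Rightarrow> nat \<Rightarrow> complex" where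
  "C12 M nv t z l = (\<Sum>k. C12_term M nv t z l k)"

definition C21 ::
    "complex measure \<Rightarrow> nat \<times> nat \<Rightarrow> (nat \<Rightarrow> nat \<Rightarrow> complex) \<Rightarrow> complex \<Rightarrow> nat \<Rightarrow> complex" where
  "C21 M nv t z l = (\<Sum>k. C21_term M nv t z l k)"

definition C22 ::
    "complex measure \<Rightarrow> nat \<times> nat \<Rightarrow> (nat \<Rightarrow> nat \<Rightarrow> complex) \<Rightarrow> complex \<Rightarrow> nat \<Rightarrow> complex" where
  "C22 M nv t z l = (\<Sum>k. C22_term M nv t z l k)"

definition C1 ::
    "complex measure \<Rightarrow> nat \<times> nat \<Rightarrow> (nat \<Rightarrow> nat \<Rightarrow> complex) \<Rightarrow> complex \<Rightarrow> nat \<Rightarrow> complex" where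
  "C1 M nv t z l = C11 M nv t z l + C12 M nv t z l"

definition C2 ::
    "complex measure \<Rightarrow> nat \<times> nat \<Rightarrow> (nat \<Rightarrow> nat \<Rightarrow> complex) \<Rightarrow> complex \<Rightarrow> nat \<Rightarrow> complex" where
  "C2 M nv t z l = C21 M nv t z l + C22 M nv t z l"


subsection \<open>Tau functions\<close>

definition tau ::
    "complex measure \<Rightarrow> nat \<times> nat \<Rightarrow> nat \<Rightarrow> (nat \<Rightarrow> nat \<Rightarrow> complex) \<Rightarrow> complex" where
  "tau M nv l t = Determinant.det (Matrix.mat l l (\<lambda>(i, j). moment_matrix M nv t i j))"

text \<open>
  \<open>tau1_next M nv a l\<close> and \<open>tau2_next M nv a l\<close> are \<open>\<tau>\<^sub>1\<^sub>,\<^sub>+\<^sub>a\<close> and \<open>\<tau>\<^sub>2\<^sub>,\<^sub>+\<^sub>a\<close> with upper index \<open>l + 1\<close>,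
  minors of size \<open>l + 1\<close> in which the last row (column) index \<open>l\<close> is replaced.
\<close>

definition tau1_next ::
    "complex measure \<Rightarrow> nat \<times> nat \<Rightarrow> nat \<Rightarrow> nat \<Rightarrow> (nat \<Rightarrow> nat \<Rightarrow> complex) \<Rightarrow> complex" where
  "tau1_next M nv a l t =
     Determinant.det (Matrix.mat (Suc l) (Suc l)
       (\<lambda>(i, j). moment_matrix M nv t (if i = l then next_ind nv a l else i) j))"

definition tau2_next ::
    "complex measure \<Rightarrow> nat \<times> nat \<Rightarrow> nat \<Rightarrow> nat \<Rightarrow> (nat \<Rightarrow> nat \<Rightarrow> complex) \<Rightarrow> complex" where
  "tau2_next M nv a l t =
     Determinant.det (Matrix.mat (Suc l) (Suc l)
       (\<lambda>(i, j). moment_matrix M nv t i (if j = l then next_ind nv a l else j)))"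


subsection \<open>Miwa shifts and their continuation\<close>

definition miwa_plus ::
    "(nat \<Rightarrow> nat \<Rightarrow> complex) \<Rightarrow> nat \<Rightarrow> complex \<Rightarrow> nat \<Rightarrow> nat \<Rightarrow> complex" where
  "miwa_plus t a w = (\<lambda>b j. if b = a then t b j + w ^ j / of_nat j else t b j)"

definition miwa_minus ::
    "(nat \<Rightarrow> nat \<Rightarrow> complex) \<Rightarrow> nat \<Rightarrow> complex \<Rightarrow> nat \<Rightarrow> nat \<Rightarrow> complex" where
  "miwa_minus t a w = (\<lambda>b j. if b = a then t b j - w ^ j / of_nat j else t b j)"

text \<open>
  For \<open>\<bar>w\<bar> < 1\<close> the series in the potential of a shifted parameter converges on the circle. For other
  \<open>w\<close> a shifted function is the value at \<open>w\<close> of the holomorphic continuation from the unit disc to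
  the disc \<open>D\<close>. On the circle the shifts by \<open>+[w]\<^sub>1\<close>, \<open>-[w]\<^sub>1\<close>, \<open>+[w]\<^sub>2\<close>, \<open>-[w]\<^sub>2\<close> multiply the measure
  by \<open>1/(1 - w u)\<close>, \<open>1 - w u\<close>, \<open>1 - w/u\<close>, \<open>1/(1 - w/u)\<close>. So the second and third give polynomials in
  \<open>w\<close>, whereas the first and fourth are continued to \<open>\<bar>w\<bar> < 1/R\<^sub>-\<close> and \<open>\<bar>w\<bar> < R\<^sub>+\<close>.
\<close>

definition continued :: "(complex \<Rightarrow> complex) \<Rightarrow> complex set \<Rightarrow> complex \<Rightarrow> complex" where
  "continued f D w =
     (THE v. \<exists>h. h holomorphic_on D \<and> (\<forall>x. norm x < 1 \<longrightarrow> h x = f x) \<and> h w = v)"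

definition at_plus1 ::
    "complex measure \<Rightarrow> ((nat \<Rightarrow> nat \<Rightarrow> complex) \<Rightarrow> complex) \<Rightarrow> (nat \<Rightarrow> nat \<Rightarrow> complex)
       \<Rightarrow> complex \<Rightarrow> complex" where
  "at_plus1 M T t = continued (\<lambda>w. T (miwa_plus t 1 w)) (eball 0 (inverse (R_minus M)))"

definition at_minus1 ::
    "((nat \<Rightarrow> nat \<Rightarrow> complex) \<Rightarrow> complex) \<Rightarrow> (nat \<Rightarrow> nat \<Rightarrow> complex) \<Rightarrow> complex \<Rightarrow> complex" where
  "at_minus1 T t = continued (\<lambda>w. T (miwa_minus t 1 w)) UNIV"

definition at_plus2 ::
    "((nat \<Rightarrow> nat \<Rightarrow> complex) \<Rightarrow> complex) \<Rightarrow> (nat \<Rightarrow> nat \<Rightarrow> complex) \<Rightarrow> complex \<Rightarrow> complex" where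
  "at_plus2 T t = continued (\<lambda>w. T (miwa_plus t 2 w)) UNIV"

definition at_minus2 ::
    "complex measure \<Rightarrow> ((nat \<Rightarrow> nat \<Rightarrow> complex) \<Rightarrow> complex) \<Rightarrow> (nat \<Rightarrow> nat \<Rightarrow> complex)
       \<Rightarrow> complex \<Rightarrow> complex" where
  "at_minus2 M T t = continued (\<lambda>w. T (miwa_minus t 2 w)) (eball 0 (R_plus M))"

end

theory Submission
  imports Defs "HOL-Complex_Analysis.Complex_Analysis"
begin

text \<open>
  Write \<open>m k\<close> for the integral of \<open>u\<^sup>k\<close> against the deformed measure and \<open>e i\<close> for the exponent of the
  \<open>i\<close>-th entry of \<open>\<chi>\<close>. Then \<open>g i j = m (e i - e j)\<close>. For every \<open>l\<close> the exponents \<open>e 0, \<dots>, e (l - 1)\<close> form an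
  interval of integers, so the leading minors of \<open>g\<close> are permuted Toeplitz determinants and do not
  vanish. Hence the Gauss--Borel factorisation exists, it is unique, and Cramer's rule
  (\<open>gauss_borel_entries\<close>) gives the entries of \<open>S\<^sub>1\<^sup>-\<^sup>1\<close> and \<open>S\<^sub>2\<close> as quotients of determinants \<open>D (e k)\<close> by
  \<open>\<tau>\<close>, where \<open>D x\<close> is a leading minor whose last row (or column) is moved to the exponent \<open>x\<close>
  (\<open>bordered_minor\<close>). Up to a monomial and, for \<open>S\<^sub>1\<close>, complex conjugation, a second kind function is
  therefore a power series \<open>\<Sum>\<^sub>n w\<^sup>n D (c \<plusminus> n)\<close>, where \<open>c\<close> is the first exponent beyond the interval
  on one side.

  A shifted \<open>\<tau>\<close>-function is the same power series. The shift divides the measure by \<open>1 - w u\<^sup>\<plusminus>\<^sup>1\<close>. Since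
  the exponents of the rows are consecutive, subtracting \<open>w\<close> times the neighbouring row cancels
  this factor in every row but the last one, and expanding the factor in the last row gives the
  series (\<open>minor_geometric_expansion\<close>). This holds for \<open>|w| < 1\<close>; the moments are bounded by
  geometric sequences in the annulus of the Fourier series, also after the deformation
  (\<open>two_sided_moment_bound\<close>), so the series converges in the larger disc and is the
  continuation there.

  For the Fourier series, the two series for the two ends of the interval fit together to
  \<open>\<Sum>\<^sub>k y\<^sup>-\<^sup>k D k\<close> over all integers \<open>k\<close>, because \<open>D\<close> vanishes inside the interval. Summing in the last row
  gives \<open>\<Sum>\<^sub>k y\<^sup>-\<^sup>k m k\<close>, which is \<open>2 \<pi>\<close> times the Fourier series, times a determinant with last row
  \<open>y\<^sup>-\<^sup>e\<close>. Column operations clear this row up to one entry and leave the moments of the measure times a linear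
  factor, that is, \<open>\<tau>\<close> after the inverse shift (\<open>two_sided_bordered_sum\<close>).

  Statements about columns follow from those about rows by transposing, which replaces \<open>u\<close> by \<open>1/u\<close>.
\<close>

section \<open>Determinants\<close>

text \<open>
  Determinants of matrices that are given by an entry function. The minors of the theorem repeat or
  exchange rows and columns, so working with entry functions is easier than working with submatrices.
\<close>

abbreviation minor :: "nat \<Rightarrow> (nat \<Rightarrow> nat \<Rightarrow> 'a) \<Rightarrow> 'a :: comm_ring_1" where
  "minor n f \<equiv> Determinant.det (Matrix.mat n n (\<lambda>(i, j). f i j))"

lemma minor_cong:
  "(\<And>i j. i < n \<Longrightarrow> j < n \<Longrightarrow> f i j = g i j) \<Longrightarrow> minor n f = minor n g"
  by (rule arg_cong[of _ _ Determinant.det], rule eq_matI) auto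

lemma minor_transpose: "minor n (\<lambda>i j. f j i) = minor n f"
proof -
  have "Matrix.mat n n (\<lambda>(i, j). f j i) = transpose_mat (Matrix.mat n n (\<lambda>(i, j). f i j))"
    by (rule eq_matI) auto
  then show ?thesis by (metis det_transpose mat_carrier)
qed

text \<open>
  The same permutation of rows and of columns contributes its sign twice. This is what makes the
  leading minors of the moment matrix in the extended ordering equal to Toeplitz determinants.
\<close>

lemma minor_permute:
  assumes p: "p permutes {0..<n}"
  shows "minor n (\<lambda>i j. f (p i) (p j)) = minor n f"
proof -
  have rows: "minor n (\<lambda>i j. h (p i) j) = signof p * minor n h" for h :: "nat \<Rightarrow> nat \<Rightarrow> 'a"
  proof -
    have "Matrix.mat n n (\<lambda>(i, j). h (p i) j) =
        Matrix.mat n n (\<lambda>(i, j). Matrix.mat n n (\<lambda>(i, j). h i j) $$ (p i, j))"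
      using permutes_in_image[OF p] by (intro eq_matI) auto
    then show ?thesis using det_permute_rows[OF mat_carrier p] by metis
  qed
  have "minor n (\<lambda>i j. f (p i) (p j)) = signof p * minor n (\<lambda>i j. f i (p j))"
    by (rule rows)
  also have "minor n (\<lambda>i j. f i (p j)) = minor n (\<lambda>i j. f j (p i))"
    by (rule minor_transpose[symmetric])
  also have "\<dots> = signof p * minor n (\<lambda>i j. f j i)"
    by (rule rows)
  also have "minor n (\<lambda>i j. f j i) = minor n f" by (rule minor_transpose)
  finally show ?thesis by (simp add: sign_def)
qed

text \<open>
  The cofactors of the last row do not involve that row, so the same coefficients serve for all last
  rows. Series in the last row can therefore be summed inside the determinant.
\<close>

lemma minor_linear_last_row:
  "\<exists>c. \<forall>x. minor (Suc l) (\<lambda>i j. if i = l then x j else f i j) = (\<Sum>j\<le>l. c j * x j)"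
proof -
  define A where "A x = Matrix.mat (Suc l) (Suc l) (\<lambda>(i, j). if i = l then x j else f i j)" for x
  have cof: "cofactor (A x) l j = cofactor (A (\<lambda>_. 0)) l j" for x j
  proof -
    have "mat_delete (A x) l j = mat_delete (A (\<lambda>_. 0)) l j"
      unfolding mat_delete_def A_def by (intro eq_matI) auto
    then show ?thesis unfolding cofactor_def by simp
  qed
  have "Determinant.det (A x) = (\<Sum>j\<le>l. cofactor (A (\<lambda>_. 0)) l j * x j)" for x
  proof -
    have "Determinant.det (A x) = (\<Sum>j<Suc l. A x $$ (l, j) * cofactor (A x) l j)"
      by (rule laplace_expansion_row) (auto simp: A_def)
    also have "\<dots> = (\<Sum>j<Suc l. cofactor (A (\<lambda>_. 0)) l j * x j)"
      
      by (rule sum.cong, simp, subst cof) (auto simp: A_def[of x])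
    finally show ?thesis by (simp add: lessThan_Suc_atMost)
  qed
  then show ?thesis unfolding A_def by blast
qed

lemma minor_repeated_row:
  assumes "i0 < l" "\<And>j. x j = f i0 j"
  shows "minor (Suc l) (\<lambda>i j. if i = l then x j else f i j) = 0"
  by (rule det_identical_rows[OF mat_carrier, of i0 l])
     (use assms in \<open>auto intro!: eq_vecI\<close>)

text \<open>
  The rows are the values of \<open>f\<close> at exponents \<open>p 0, \<dots>, p l\<close> which form an interval with end \<open>p l\<close> in
  the direction \<open>s\<close>, in any order. Subtracting from every other row \<open>w\<close> times its neighbour in the direction \<open>s\<close>
  is a multiplication by a matrix that would be unitriangular if the exponents were sorted. The
  unsorted case needs no sorting: by the Leibniz formula only the identity contributes to the
  determinant of that matrix.
\<close>

lemma minor_row_operation: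
  fixes p :: "nat \<Rightarrow> int" and f :: "int \<Rightarrow> nat \<Rightarrow> 'a :: comm_ring_1"
  assumes inj: "inj_on p {..l}" and s: "s \<noteq> 0"
    and succ: "\<And>i. i < l \<Longrightarrow> \<exists>k\<le>l. p k = p i + s"
  shows "minor (Suc l) (\<lambda>i j. f (p i) j) =
         minor (Suc l) (\<lambda>i j. if i = l then f (p l) j else f (p i) j - w * f (p i + s) j)"
proof -
  define e :: "nat \<Rightarrow> nat \<Rightarrow> 'a" where
    "e i k = (if i = k then 1 else if i < l \<and> p k = p i + s then - w else 0)" for i k
  let ?E = "Matrix.mat (Suc l) (Suc l) (\<lambda>(i, j). e i j)"
  let ?X = "Matrix.mat (Suc l) (Suc l) (\<lambda>(i, j). f (p i) j)"
  let ?Y = "Matrix.mat (Suc l) (Suc l)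
    (\<lambda>(i, j). if i = l then f (p l) j else f (p i) j - w * f (p i + s) j)"
  have row: "(\<Sum>k<Suc l. e i k * f (p k) j) =
      (if i = l then f (p l) j else f (p i) j - w * f (p i + s) j)" if i: "i < Suc l" for i j
  proof (cases "i = l")
    case True
    have "(\<Sum>k<Suc l. e i k * f (p k) j) = (\<Sum>k<Suc l. if k = l then f (p l) j else 0)"
      by (rule sum.cong) (auto simp: e_def True)
    then show ?thesis using True by simp
  next
    case False
    then have "i < l" using i by simp
    then obtain k0 where k0: "k0 \<le> l" "p k0 = p i + s" using succ by blast
    have uniq: "p k = p i + s \<longleftrightarrow> k = k0" if "k \<le> l" for k
      using inj_onD[OF inj, of k k0] k0 that by auto
    have "k0 \<noteq> i" using k0 s by auto
    have "(\<Sum>k<Suc l. e i k * f (p k) j) =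
        (\<Sum>k<Suc l. (if k = i then f (p i) j else 0) + (if k = k0 then - w * f (p k0) j else 0))"
      by (rule sum.cong) (use uniq \<open>k0 \<noteq> i\<close> \<open>i < l\<close> in \<open>auto simp: e_def\<close>)
    also have "\<dots> = f (p i) j - w * f (p i + s) j"
      using k0 i by (simp add: sum.distrib del: sum.lessThan_Suc)
    finally show ?thesis using False by simp
  qed
  have "?E * ?X = ?Y"
    by (rule eq_matI) (auto simp: scalar_prod_def row atLeast0LessThan simp del: sum.lessThan_Suc)
  then have "Determinant.det ?Y = Determinant.det ?E * Determinant.det ?X"
    using det_mult[of ?E "Suc l" ?X] by simp
  moreover have "Determinant.det ?E = 1"
  proof -
    let ?P = "{\<sigma>. \<sigma> permutes {0..<Suc l}}"
    have "Determinant.det ?E = (\<Sum>\<sigma>\<in>?P. signof \<sigma> * (\<Prod>i = 0..<Suc l. ?E $$ (i, \<sigma> i)))"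
      by (rule det_def') simp
    also have "\<dots> = (\<Sum>\<sigma>\<in>?P. if \<sigma> = id then 1 else 0)"
    proof (rule sum.cong[OF refl])
      fix \<sigma> assume "\<sigma> \<in> ?P"
      then have \<sigma>: "\<sigma> permutes {0..<Suc l}" by simp
      have lt: "\<sigma> i < Suc l" if "i < Suc l" for i
        using permutes_in_image[OF \<sigma>, of i] that by simp
      show "signof \<sigma> * (\<Prod>i = 0..<Suc l. ?E $$ (i, \<sigma> i)) = (if \<sigma> = id then 1 else 0)"
      proof (cases "\<sigma> = id")
        case True
        then show ?thesis by (simp add: e_def del: prod.op_ivl_Suc)
      next
        case False
        have "\<exists>i<Suc l. e i (\<sigma> i) = 0"
        proof (rule ccontr)
          assume "\<not> ?thesis"
          then have nz: "e i (\<sigma> i) \<noteq> 0" if "i < Suc l" for i using that by blast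
          \<comment> \<open>A permutation keeps the sum of the exponents, so it cannot move some of them by \<open>s\<close> and
              none of them by \<open>-s\<close>.\<close>
          have step: "p (\<sigma> i) = p i \<or> p (\<sigma> i) = p i + s" if "i < Suc l" for i
            using nz[OF that] by (auto simp: e_def split: if_splits)
          have "(\<Sum>i = 0..<Suc l. p (\<sigma> i)) = (\<Sum>i = 0..<Suc l. p i)"
            using sum.permute[OF \<sigma>, of p] by (simp add: o_def)
          then have "(\<Sum>i = 0..<Suc l. s * (p (\<sigma> i) - p i)) = 0"
            by (simp only: sum_distrib_left[symmetric] sum_subtractf) simp
          moreover have "s * (p (\<sigma> i) - p i) \<ge> 0" if "i \<in> {0..<Suc l}" for i
            using step[of i] that by auto
          ultimately have "\<forall>i\<in>{0..<Suc l}. s * (p (\<sigma> i) - p i) = 0"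
            by (subst (asm) sum_nonneg_eq_0_iff) auto
          then have "\<sigma> i = i" if "i < Suc l" for i
            using that s lt[OF that] inj_onD[OF inj, of "\<sigma> i" i] by auto
          then have "\<sigma> = id"
            using permutes_not_in[OF \<sigma>] by (intro ext) (metis atLeastLessThan_iff id_apply)
          then show False using False by simp
        qed
        then obtain i where "i < Suc l" "e i (\<sigma> i) = 0" by blast
        then have "(\<Prod>i = 0..<Suc l. ?E $$ (i, \<sigma> i)) = 0"
          using lt by (intro prod_zero) auto
        then show ?thesis using False by simp
      qed
    qed
    also have "\<dots> = 1"
      using finite_permutations[of "{0..<Suc l}"] permutes_id[of "{0..<Suc l}"]
      by (simp add: sum.delta')
    finally show ?thesis .
  qed
  ultimately show ?thesis by simp
qed

section \<open>Gauss--Borel factorisation of semi-infinite matrices\<close>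

abbreviation smat_one :: "nat \<Rightarrow> nat \<Rightarrow> complex" where
  "smat_one \<equiv> \<lambda>i j. if i = j then 1 else 0"

text \<open>
  Products with a lower triangular left factor are finite sums, so the usual rules of matrix algebra
  hold for them although they fail for general semi-infinite matrices.
\<close>

lemma smat_mult_lower:
  assumes "lower_unitriangular A"
  shows "smat_mult A B i j = (\<Sum>k\<le>i. A i k * B k j)"
  unfolding smat_mult_def
  by (rule suminf_finite) (use assms in \<open>auto simp: lower_unitriangular_def\<close>)

lemma smat_mult_one_right: "smat_mult A smat_one = A"
proof (intro ext)
  fix i j
  have "smat_mult A smat_one i j = (\<Sum>k\<in>{j}. A i k * smat_one k j)"
    unfolding smat_mult_def by (rule suminf_finite) auto
  then show "smat_mult A smat_one i j = A i j" by simp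
qed

lemma smat_mult_one_left: "smat_mult smat_one A = A"
proof (intro ext)
  fix i j
  have "smat_mult smat_one A i j = (\<Sum>k\<in>{i}. smat_one i k * A k j)"
    unfolding smat_mult_def by (rule suminf_finite) auto
  then show "smat_mult smat_one A i j = A i j" by simp
qed

lemma lower_unitriangular_mult:
  assumes A: "lower_unitriangular A" and B: "lower_unitriangular B"
  shows "lower_unitriangular (smat_mult A B)"
proof -
  have "smat_mult A B i i = 1" for i
  proof -
    have "(\<Sum>k\<le>i. A i k * B k i) = (\<Sum>k\<le>i. if k = i then 1 else 0)"
      by (rule sum.cong) (use A B in \<open>auto simp: lower_unitriangular_def\<close>)
    then show ?thesis by (simp add: smat_mult_lower[OF A])
  qed
  moreover have "smat_mult A B i j = 0" if "i < j" for i j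
    unfolding smat_mult_lower[OF A]
    by (rule sum.neutral) (use B that in \<open>auto simp: lower_unitriangular_def\<close>)
  ultimately show ?thesis by (simp add: lower_unitriangular_def)
qed

lemma smat_mult_assoc:
  assumes A: "lower_unitriangular A" and B: "lower_unitriangular B"
  shows "smat_mult A (smat_mult B C) = smat_mult (smat_mult A B) C"
proof (intro ext)
  fix i j
  have trunc: "(\<Sum>m\<le>k. B k m * x m) = (\<Sum>m\<le>i. B k m * x m)" if "k \<le> i" for k x
    by (rule sum.mono_neutral_left) (use B that in \<open>auto simp: lower_unitriangular_def\<close>)
  have "smat_mult A (smat_mult B C) i j = (\<Sum>k\<le>i. A i k * (\<Sum>m\<le>i. B k m * C m j))"
    by (simp add: smat_mult_lower[OF A] smat_mult_lower[OF B] trunc)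
  also have "\<dots> = (\<Sum>m\<le>i. (\<Sum>k\<le>i. A i k * B k m) * C m j)"
    by (simp add: sum_distrib_left sum_distrib_right mult.assoc, rule sum.swap)
  also have "\<dots> = smat_mult (smat_mult A B) C i j"
    by (simp add: smat_mult_lower[OF A] smat_mult_lower[OF lower_unitriangular_mult[OF A B]])
  finally show "smat_mult A (smat_mult B C) i j = smat_mult (smat_mult A B) C i j" .
qed

fun forward_substitution ::
    "(nat \<Rightarrow> nat \<Rightarrow> complex) \<Rightarrow> (nat \<Rightarrow> complex) \<Rightarrow> nat \<Rightarrow> complex" where
  "forward_substitution A y i = y i - (\<Sum>k<i. A i k * forward_substitution A y k)"

declare forward_substitution.simps [simp del]

lemma lower_unitriangular_right_inverse:
  assumes A: "lower_unitriangular A"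
  obtains B where "lower_unitriangular B" "smat_mult A B = smat_one"
proof
  define B where "B i j = forward_substitution A (\<lambda>i. smat_one i j) i" for i j
  have rec: "B i j = smat_one i j - (\<Sum>k<i. A i k * B k j)" for i j
    unfolding B_def by (subst forward_substitution.simps) simp
  have above: "B i j = 0" if "i < j" for i j
    using that
  proof (induction i rule: less_induct)
    case (less i)
    then show ?case by (subst rec) auto
  qed
  have "B i i = 1" for i
    by (subst rec) (simp add: above)
  then show "lower_unitriangular B" using above by (simp add: lower_unitriangular_def)
  have "(\<Sum>k\<le>i. A i k * B k j) = smat_one i j" for i j
  proof -
    have "{..i} = insert i {..<i}" by auto
    then have "(\<Sum>k\<le>i. A i k * B k j) = A i i * B i j + (\<Sum>k<i. A i k * B k j)" by simp
    then show ?thesis using A by (simp add: rec[of i j] lower_unitriangular_def)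
  qed
  then show "smat_mult A B = smat_one"
    by (intro ext) (simp add: smat_mult_lower[OF A])
qed

text \<open>
  If \<open>B\<close> is a right inverse of \<open>A\<close> and \<open>C\<close> one of \<open>B\<close>, then \<open>A = A (B C) = (A B) C = C\<close>.
\<close>

lemma lower_right_inverse_is_left_inverse:
  assumes A: "lower_unitriangular A" and B: "lower_unitriangular B"
    and AB: "smat_mult A B = smat_one"
  shows "smat_mult B A = smat_one"
proof -
  obtain C where C: "lower_unitriangular C" "smat_mult B C = smat_one"
    using lower_unitriangular_right_inverse[OF B] .
  have "A = smat_mult A (smat_mult B C)" by (simp add: C smat_mult_one_right)
  also have "\<dots> = C" by (simp add: smat_mult_assoc[OF A B] AB smat_mult_one_left)
  finally show ?thesis using C by simp
qed

lemma lower_inverse_eqI: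
  assumes A: "lower_unitriangular A" and B: "lower_unitriangular B"
    and AB: "smat_mult A B = smat_one"
  shows "lower_inverse A = B"
  unfolding lower_inverse_def
proof (rule the_equality)
  show "lower_unitriangular B \<and> smat_mult A B = smat_one \<and> smat_mult B A = smat_one"
    using B AB lower_right_inverse_is_left_inverse[OF A B AB] by blast
next
  fix B'
  assume B': "lower_unitriangular B' \<and> smat_mult A B' = smat_one \<and> smat_mult B' A = smat_one"
  then have "B' = smat_mult B' (smat_mult A B)" by (simp add: AB smat_mult_one_right)
  also have "\<dots> = B" using B' A by (simp add: smat_mult_assoc smat_mult_one_left)
  finally show "B' = B" .
qed

lemma lower_inverse_properties:
  assumes A: "lower_unitriangular A"
  shows "lower_unitriangular (lower_inverse A)" "smat_mult A (lower_inverse A) = smat_one"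
    "lower_inverse (lower_inverse A) = A"
proof -
  obtain B where B: "lower_unitriangular B" "smat_mult A B = smat_one"
    using lower_unitriangular_right_inverse[OF A] .
  note eq = lower_inverse_eqI[OF A B]
  show "lower_unitriangular (lower_inverse A)" "smat_mult A (lower_inverse A) = smat_one"
    using B eq by auto
  show "lower_inverse (lower_inverse A) = A"
    unfolding eq
    by (rule lower_inverse_eqI[OF B(1) A lower_right_inverse_is_left_inverse[OF A B]])
qed

text \<open>
  The first \<open>l + 1\<close> columns of \<open>g = L U\<close> only see the leading block of \<open>U\<close>, and its first \<open>l + 1\<close>
  rows only see that of \<open>L\<close>. A minor whose last row or column is exchanged therefore is the product of
  two triangular determinants.
\<close>

lemma factorised_minor:
  assumes L: "lower_unitriangular L" and U: "upper_triangular_smat U"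
    and rows: "\<And>i. i < l \<Longrightarrow> p i = i" and cols: "\<And>j. j < l \<Longrightarrow> q j = j"
    and one: "p l = l \<or> q l = l"
  shows "minor (Suc l) (\<lambda>i j. smat_mult L U (p i) (q j)) = L (p l) l * ((\<Prod>i<l. U i i) * U l (q l))"
proof -
  let ?A = "Matrix.mat (Suc l) (Suc l) (\<lambda>(i, j). L (p i) j)"
  let ?B = "Matrix.mat (Suc l) (Suc l) (\<lambda>(i, j). U i (q j))"
  have entry: "smat_mult L U (p i) (q j) = (\<Sum>m<Suc l. L (p i) m * U m (q j))"
    if "i < Suc l" "j < Suc l" for i j
    unfolding smat_mult_def
  proof (rule suminf_finite)
    fix m assume m: "m \<notin> {..<Suc l}"
    have "p i \<le> l \<or> q j \<le> l"
      using that rows[of i] cols[of j] one by (cases "i = l"; cases "j = l") auto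
    then have "p i < m \<or> q j < m" using m by auto
    then show "L (p i) m * U m (q j) = 0"
      using L U by (auto simp: lower_unitriangular_def upper_triangular_smat_def)
  qed simp
  have "Matrix.mat (Suc l) (Suc l) (\<lambda>(i, j). smat_mult L U (p i) (q j)) = ?A * ?B"
    by (rule eq_matI) (auto simp: scalar_prod_def entry atLeast0LessThan simp del: sum.lessThan_Suc)
  then have "minor (Suc l) (\<lambda>i j. smat_mult L U (p i) (q j)) = Determinant.det ?A * Determinant.det ?B"
    using det_mult[of ?A "Suc l" ?B] by simp
  moreover have "Determinant.det ?A = L (p l) l"
  proof -
    have "Determinant.det ?A = prod_list (diag_mat ?A)"
    proof (rule det_lower_triangular)
      show "?A $$ (i, j) = 0" if "i < j" "j < Suc l" for i j
        using that rows[of i] L by (auto simp: lower_unitriangular_def)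
    qed simp
    also have "\<dots> = (\<Prod>i<Suc l. L (p i) i)"
      by (simp add: prod_list_diag_prod atLeast0LessThan del: prod.lessThan_Suc)
    also have "\<dots> = L (p l) l"
      using rows L by (simp add: lower_unitriangular_def)
    finally show ?thesis .
  qed
  moreover have "Determinant.det ?B = (\<Prod>i<l. U i i) * U l (q l)"
  proof -
    have "Determinant.det ?B = prod_list (diag_mat ?B)"
    proof (rule det_upper_triangular[OF _ mat_carrier])
      show "upper_triangular ?B"
        unfolding upper_triangular_def
      proof (intro allI impI)
        fix i j assume "i < dim_row ?B" "j < i"
        then show "?B $$ (i, j) = 0"
          using cols[of j] U by (simp add: upper_triangular_smat_def)
      qed
    qed
    also have "\<dots> = (\<Prod>i<Suc l. U i (q i))"
      by (simp add: prod_list_diag_prod atLeast0LessThan del: prod.lessThan_Suc)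
    also have "\<dots> = (\<Prod>i<l. U i i) * U l (q l)"
      using cols by simp
    finally show ?thesis .
  qed
  ultimately show ?thesis by simp
qed

lemma factorised_leading_minor:
  assumes L: "lower_unitriangular L" and U: "upper_triangular_smat U"
  shows "minor n (smat_mult L U) = (\<Prod>i<n. U i i)"
proof (cases n)
  case 0
  then show ?thesis by (simp add: det_dim_zero)
next
  case (Suc l)
  then show ?thesis
    using factorised_minor[OF L U, of l "\<lambda>i. i" "\<lambda>j. j"] L
    by (simp add: lower_unitriangular_def)
qed

text \<open>
  A factorisation is determined by the minors of \<open>g\<close>. This gives the uniqueness that the descriptions
  of \<open>S1\<close> and \<open>S2\<close> rely on, and also expresses their entries through the minors in the theorem.
\<close>

lemma factorisation_entries:
  assumes L: "lower_unitriangular L" and U: "upper_triangular_smat U"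
    and g: "g = smat_mult L U" and nz: "\<And>n. minor n g \<noteq> 0"
  shows "L k l = minor (Suc l) (\<lambda>i j. g (if i = l then k else i) j) / minor (Suc l) g"
    "U l k = minor (Suc l) (\<lambda>i j. g i (if j = l then k else j)) / minor l g"
proof -
  have "minor (Suc l) (\<lambda>i j. g (if i = l then k else i) j) = L k l * minor (Suc l) g"
    using factorised_minor[OF L U, of l "\<lambda>i. if i = l then k else i" "\<lambda>j. j"]
      factorised_leading_minor[OF L U, of "Suc l"] g by simp
  then show "L k l = minor (Suc l) (\<lambda>i j. g (if i = l then k else i) j) / minor (Suc l) g"
    using nz[of "Suc l"] by simp
  have "minor (Suc l) (\<lambda>i j. g i (if j = l then k else j)) = minor l g * U l k"
    using factorised_minor[OF L U, of l "\<lambda>i. i" "\<lambda>j. if j = l then k else j"]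
      factorised_leading_minor[OF L U, of l] g L by (simp add: lower_unitriangular_def)
  then show "U l k = minor (Suc l) (\<lambda>i j. g i (if j = l then k else j)) / minor l g"
    using nz[of l] by simp
qed

text \<open>
  Gaussian elimination without pivoting: step \<open>n\<close> clears row and column \<open>n\<close>. The pivot
  \<open>schur_complement g n n n\<close> is nonzero when the leading minors of \<open>g\<close> are.
\<close>

fun schur_complement ::
    "(nat \<Rightarrow> nat \<Rightarrow> complex) \<Rightarrow> nat \<Rightarrow> nat \<Rightarrow> nat \<Rightarrow> complex" where
  "schur_complement g 0 i j = g i j"
| "schur_complement g (Suc n) i j = schur_complement g n i j
     - schur_complement g n i n * schur_complement g n n j / schur_complement g n n n"

lemma factorisation_exists:
  assumes nz: "\<And>n. minor n g \<noteq> (0 :: complex)"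
  obtains L U where "lower_unitriangular L" "upper_triangular_smat U" "g = smat_mult L U"
proof -
  let ?s = "schur_complement g"
  have vanish: "\<forall>i j. i < n \<or> j < n \<longrightarrow> ?s n i j = 0" if "\<forall>m<n. ?s m m m \<noteq> 0" for n
    using that
  proof (induction n)
    case (Suc n)
    then have IH: "\<forall>i j. i < n \<or> j < n \<longrightarrow> ?s n i j = 0" "?s n n n \<noteq> 0" by auto
    show ?case
    proof (intro allI impI)
      fix i j assume "i < Suc n \<or> j < Suc n"
      then have "i < n \<or> j < n \<or> i = n \<or> j = n" by auto
      then show "?s (Suc n) i j = 0" using IH by auto
    qed
  qed simp
  define L where "L i l = (if i = l then 1 else ?s l i l / ?s l l l)" for i l
  define U where "U l j = ?s l l j" for l j
  have expand: "g i j = (\<Sum>m<n. L i m * U m j) + ?s n i j" if "\<forall>m<n. ?s m m m \<noteq> 0" for n i j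
    using that
  proof (induction n)
    case (Suc n)
    then have IH: "g i j = (\<Sum>m<n. L i m * U m j) + ?s n i j" and "?s n n n \<noteq> 0" by auto
    then have "?s n i j = L i n * U n j + ?s (Suc n) i j"
      by (auto simp: L_def U_def)
    then show ?case using IH by simp
  qed simp
  \<comment> \<open>The leading minor of order \<open>n + 1\<close> is the product of the first \<open>n + 1\<close> pivots. The matrices \<open>L'\<close> and
      \<open>U'\<close> are cut off after index \<open>n\<close> because nothing is known yet about the later pivots.\<close>
  have pivot: "?s n n n \<noteq> 0" for n
  proof (induction n rule: less_induct)
    case (less n)
    define L' where "L' i l = (if l \<le> n then L i l else smat_one i l)" for i l
    define U' where "U' l j = (if l \<le> n then U l j else 0)" for l j
    have L': "lower_unitriangular L'"
      unfolding lower_unitriangular_def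
    proof (intro conjI allI impI)
      fix i j :: nat assume "i < j"
      then show "L' i j = 0"
        using vanish[of j] less by (auto simp: L'_def L_def)
    qed (simp add: L'_def L_def)
    have U': "upper_triangular_smat U'"
      unfolding upper_triangular_smat_def
    proof (intro allI impI)
      fix i j :: nat assume "j < i"
      then show "U' i j = 0" using vanish[of i] less by (auto simp: U'_def U_def)
    qed
    have g: "g i j = smat_mult L' U' i j" if "i \<le> n" "j \<le> n" for i j
    proof -
      have "smat_mult L' U' i j = (\<Sum>m\<le>i. L' i m * U' m j)" by (rule smat_mult_lower[OF L'])
      also have "\<dots> = (\<Sum>m<Suc n. L' i m * U' m j)"
        by (rule sum.mono_neutral_left) (use L' that in \<open>auto simp: lower_unitriangular_def\<close>)
      also have "\<dots> = (\<Sum>m<n. L i m * U m j) + L i n * U n j"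
        by (simp add: L'_def U'_def)
      also have "L i n * U n j = ?s n i j"
      proof (cases "i = n")
        case True
        then show ?thesis by (simp add: L_def U_def)
      next
        case False
        then have "i < n" using that by simp
        then have "?s n i n = 0" "?s n i j = 0" using vanish[of n] less by auto
        then show ?thesis by (simp add: L_def False)
      qed
      finally show ?thesis using expand[of n i j] less by simp
    qed
    have "minor (Suc n) g = minor (Suc n) (smat_mult L' U')"
      by (rule minor_cong) (simp add: g)
    then have "(\<Prod>i<Suc n. U' i i) \<noteq> 0"
      using factorised_leading_minor[OF L' U', of "Suc n"] nz[of "Suc n"] by simp
    then show ?case by (simp add: U'_def U_def)
  qed
  show thesis
  proof
    show L: "lower_unitriangular L"
      using vanish pivot by (auto simp: lower_unitriangular_def L_def)
    show U: "upper_triangular_smat U"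
      using vanish pivot by (auto simp: upper_triangular_smat_def U_def)
    have "g i j = smat_mult L U i j" for i j
    proof -
      have "g i j = (\<Sum>m<Suc i. L i m * U m j)"
        using expand[of "Suc i" i j] vanish[of "Suc i"] pivot by simp
      then show ?thesis by (simp only: smat_mult_lower[OF L] lessThan_Suc_atMost)
    qed
    then show "g = smat_mult L U" by (intro ext)
  qed
qed

lemma gauss_borel_entries:
  assumes nz: "\<And>n. minor n g \<noteq> (0 :: complex)"
  shows "lower_inverse (fst (gauss_borel g)) k l =
      minor (Suc l) (\<lambda>i j. g (if i = l then k else i) j) / minor (Suc l) g"
    "snd (gauss_borel g) l k =
      minor (Suc l) (\<lambda>i j. g i (if j = l then k else j)) / minor l g"
proof -
  obtain L U where L: "lower_unitriangular L" and U: "upper_triangular_smat U"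
    and g: "g = smat_mult L U"
    using factorisation_exists[OF nz] .
  have gb: "gauss_borel g = (lower_inverse L, U)"
    unfolding gauss_borel_def
  proof (rule the_equality)
    show "case (lower_inverse L, U) of (A, B) \<Rightarrow>
        lower_unitriangular A \<and> upper_triangular_smat B \<and> g = smat_mult (lower_inverse A) B"
      using U g lower_inverse_properties[OF L] by simp
  next
    fix P
    assume P: "case P of (A, B) \<Rightarrow>
        lower_unitriangular A \<and> upper_triangular_smat B \<and> g = smat_mult (lower_inverse A) B"
    obtain A B where AB: "P = (A, B)" by force
    then have A: "lower_unitriangular A" and B: "upper_triangular_smat B"
      and gAB: "g = smat_mult (lower_inverse A) B" using P by auto
    note A' = lower_inverse_properties[OF A]
    have "lower_inverse A = L" "B = U"
      by (intro ext; simp only: factorisation_entries[OF A'(1) B gAB nz]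
          factorisation_entries[OF L U g nz])+
    then show "P = (lower_inverse L, U)" using AB A'(3) by simp
  qed
  show "lower_inverse (fst (gauss_borel g)) k l =
      minor (Suc l) (\<lambda>i j. g (if i = l then k else i) j) / minor (Suc l) g"
    unfolding gb fst_conv lower_inverse_properties(3)[OF L] by (rule factorisation_entries[OF L U g nz])
  show "snd (gauss_borel g) l k =
      minor (Suc l) (\<lambda>i j. g i (if j = l then k else j)) / minor l g"
    unfolding gb snd_conv by (rule factorisation_entries[OF L U g nz])
qed

section \<open>The extended ordering\<close>

declare One_nat_def [simp del] \<comment> \<open>keeps the side label \<open>1\<close> from turning into \<open>Suc 0\<close>\<close>

text \<open>
  With \<open>a = 1\<close> for the non-negative powers and \<open>a = 2\<close> for the negative ones, \<open>edge_exp nv a l\<close> is the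
  exponent of side \<open>a\<close> that has not yet occurred among the first \<open>l\<close> entries of \<open>\<chi>\<close> and is nearest to
  zero. Later exponents of that side follow in steps of \<open>side a\<close>. Every formula for the two sides is
  stated once in these terms.
\<close>

definition index_count :: "nat \<times> nat \<Rightarrow> nat \<Rightarrow> nat \<Rightarrow> nat" where
  "index_count nv a l = card {i. i < l \<and> ind_a nv i = a}"

definition edge_exp :: "nat \<times> nat \<Rightarrow> nat \<Rightarrow> nat \<Rightarrow> int" where
  "edge_exp nv a l = (if a = 1 then int (index_count nv a l) else - int (index_count nv a l) - 1)"

definition side :: "nat \<Rightarrow> int" where
  "side a = (if a = 1 then 1 else - 1)"

lemma ind_a_cases: "ind_a nv l = 1 \<or> ind_a nv l = 2"
  by (simp add: ind_a_def)

lemma index_count_0 [simp]: "index_count nv a 0 = 0"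
  by (simp add: index_count_def)

lemma index_count_Suc:
  "index_count nv a (Suc l) = index_count nv a l + (if ind_a nv l = a then 1 else 0)"
proof -
  have "{i. i < Suc l \<and> ind_a nv i = a} =
      (if ind_a nv l = a then insert l {i. i < l \<and> ind_a nv i = a}
       else {i. i < l \<and> ind_a nv i = a})"
    by (auto simp: less_Suc_eq)
  then show ?thesis by (simp add: index_count_def)
qed

lemma nu_plus_eq: "nu_plus nv l = index_count nv 1 (Suc l)"
  and nu_minus_eq: "nu_minus nv l = index_count nv 2 (Suc l)"
  by (simp_all add: nu_plus_def nu_minus_def index_count_def less_Suc_eq_le)

lemma ind_a_eq_1_iff: "ind_a nv l = 1 \<longleftrightarrow> l mod (fst nv + snd nv) < fst nv"
proof -
  have "chi_exp nv l \<ge> 0 \<longleftrightarrow> l mod (fst nv + snd nv) < fst nv"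
  proof -
    have neg: "\<not> 0 \<le> - int (k + 1)" for k by linarith
    show ?thesis
      unfolding chi_exp_def Let_def
      by (cases "l mod (fst nv + snd nv) < fst nv") (simp_all only: if_True if_False neg, simp)
  qed
  then show ?thesis by (simp add: ind_a_def)
qed

lemma index_count_formula:
  assumes "fst nv \<ge> 1" "snd nv \<ge> 1"
  shows "index_count nv 1 l =
      l div (fst nv + snd nv) * fst nv + min (l mod (fst nv + snd nv)) (fst nv)" (is ?A)
    and "index_count nv 2 l =
      l div (fst nv + snd nv) * snd nv + (l mod (fst nv + snd nv) - fst nv)" (is ?B)
proof -
  have "?A \<and> ?B"
  proof (induction l)
    case 0
    then show ?case by simp
  next
    case (Suc l)
    have two: "ind_a nv l = 2 \<longleftrightarrow> \<not> l mod (fst nv + snd nv) < fst nv"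
      using ind_a_eq_1_iff[of nv l] ind_a_cases[of nv l] by auto
    show ?case
      using Suc assms mod_less_divisor[of "fst nv + snd nv" l]
      by (auto simp: index_count_Suc ind_a_eq_1_iff two div_Suc mod_Suc)
  qed
  then show ?A ?B by auto
qed

text \<open>
  After this lemma the block structure of the ordering is forgotten: each entry of \<open>\<chi>\<close> extends the
  interval of exponents by one step on one of its two sides.
\<close>

lemma chi_exp_eq_edge_exp:
  assumes "fst nv \<ge> 1" "snd nv \<ge> 1"
  shows "chi_exp nv l = edge_exp nv (ind_a nv l) l"
proof (cases "l mod (fst nv + snd nv) < fst nv")
  case True
  then have "ind_a nv l = 1" by (simp add: ind_a_eq_1_iff)
  then show ?thesis
    using True index_count_formula(1)[OF assms, of l] by (simp add: chi_exp_def Let_def edge_exp_def)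
next
  case False
  then have "ind_a nv l = 2" using ind_a_eq_1_iff[of nv l] ind_a_cases[of nv l] by auto
  then show ?thesis
    using False index_count_formula(2)[OF assms, of l] by (simp add: chi_exp_def Let_def edge_exp_def)
qed

lemma chi_exp_interval:
  assumes "fst nv \<ge> 1" "snd nv \<ge> 1"
  shows "chi_exp nv ` {..<l} = {- int (index_count nv 2 l) ..< int (index_count nv 1 l)}"
    and "inj_on (chi_exp nv) {..<l}"
proof -
  have "chi_exp nv ` {..<l} = {- int (index_count nv 2 l) ..< int (index_count nv 1 l)} \<and>
      inj_on (chi_exp nv) {..<l}"
  proof (induction l)
    case 0
    then show ?case by simp
  next
    case (Suc l)
    have e: "chi_exp nv l = (if ind_a nv l = 1 then int (index_count nv 1 l)
        else - int (index_count nv 2 l) - 1)"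
      using chi_exp_eq_edge_exp[OF assms, of l] ind_a_cases[of nv l] by (auto simp: edge_exp_def)
    show ?case
      using Suc ind_a_cases[of nv l]
      by (auto simp: lessThan_Suc e index_count_Suc)
  qed
  then show "chi_exp nv ` {..<l} = {- int (index_count nv 2 l) ..< int (index_count nv 1 l)}"
    "inj_on (chi_exp nv) {..<l}" by auto
qed

text \<open>
  This is the shape of exponents to which the row operations on minors apply.
\<close>

lemma edge_exp_successor:
  fixes i l :: nat
  assumes nv: "fst nv \<ge> 1" "snd nv \<ge> 1" and a: "a = 1 \<or> a = 2"
  defines "p \<equiv> \<lambda>i. if i = l then edge_exp nv a l else chi_exp nv i"
  shows "inj_on p {..l}" and "i < l \<Longrightarrow> \<exists>k\<le>l. p k = p i + side a"
proof -
  note im = chi_exp_interval(1)[OF nv, of l]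
  have below: "p i \<in> {- int (index_count nv 2 l) ..< int (index_count nv 1 l)}" if "i < l" for i
    using im that by (auto simp: p_def)
  have p_l: "p l = edge_exp nv a l" by (simp add: p_def)
  have "inj_on p {..<l}"
    using chi_exp_interval(2)[OF nv, of l] by (auto simp: inj_on_def p_def)
  moreover have "p l \<notin> p ` {..<l}"
  proof
    assume "p l \<in> p ` {..<l}"
    then have "p l \<in> {- int (index_count nv 2 l) ..< int (index_count nv 1 l)}"
      using below by auto
    then show False using a p_l by (auto simp: edge_exp_def)
  qed
  ultimately show "inj_on p {..l}"
    by (simp add: lessThan_Suc_atMost[symmetric] lessThan_Suc)
  show "\<exists>k\<le>l. p k = p i + side a" if "i < l"
  proof (cases "p i + side a = p l")
    case True
    then show ?thesis by (intro exI[of _ l]) simp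
  next
    case False
    then have "p i + side a \<in> {- int (index_count nv 2 l) ..< int (index_count nv 1 l)}"
      using below[OF that] a p_l by (auto simp: edge_exp_def side_def)
    then obtain k where "k < l" "chi_exp nv k = p i + side a"
      unfolding im[symmetric] by auto
    then show ?thesis by (intro exI[of _ k]) (simp add: p_def)
  qed
qed

lemma ind_a_unbounded:
  assumes nv: "fst nv \<ge> 1" "snd nv \<ge> 1" and a: "a = 1 \<or> a = 2"
  shows "\<exists>k\<ge>l. ind_a nv k = a"
proof (cases "a = 1")
  case True
  show ?thesis
    using nv True by (intro exI[of _ "l * (fst nv + snd nv)"]) (simp add: ind_a_eq_1_iff)
next
  case False
  have "(l * (fst nv + snd nv) + fst nv) mod (fst nv + snd nv) = fst nv"
    using nv by simp
  then have "ind_a nv (l * (fst nv + snd nv) + fst nv) \<noteq> 1"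
    unfolding ind_a_eq_1_iff by simp
  moreover have "l \<le> l * (fst nv + snd nv) + fst nv"
    using nv by (simp add: trans_le_add1)
  ultimately show ?thesis
    using False a ind_a_cases[of nv "l * (fst nv + snd nv) + fst nv"] by metis
qed

text \<open>
  The indices \<open>k \<ge> l\<close> on side \<open>a\<close>, in increasing order. Along them the exponent moves away from the
  edge in unit steps, so sums over these indices become power series.
\<close>

lemma later_indices:
  assumes nv: "fst nv \<ge> 1" "snd nv \<ge> 1" and a: "a = 1 \<or> a = 2"
  obtains \<kappa> where "strict_mono \<kappa>" "range \<kappa> = {k. l \<le> k \<and> ind_a nv k = a}"
    "\<kappa> 0 = next_ind nv a l"
    "\<And>n. index_count nv a (\<kappa> n) = index_count nv a l + n"
    "\<And>n. chi_exp nv (\<kappa> n) = edge_exp nv a l + side a * int n"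
proof
  let ?S = "{k. l \<le> k \<and> ind_a nv k = a}"
  let ?\<kappa> = "enumerate ?S"
  have inf: "infinite ?S"
    unfolding infinite_nat_iff_unbounded_le
  proof
    fix m
    obtain k where "k \<ge> max l m" "ind_a nv k = a" using ind_a_unbounded[OF nv a] by blast
    then show "\<exists>n\<ge>m. n \<in> ?S" by auto
  qed
  show mono: "strict_mono ?\<kappa>" using strict_mono_enumerate[OF inf] .
  show range: "range ?\<kappa> = ?S" using range_enumerate[OF inf] .
  show "?\<kappa> 0 = next_ind nv a l" by (simp add: enumerate_0 next_ind_def)
  have mem: "l \<le> ?\<kappa> n" "ind_a nv (?\<kappa> n) = a" for n
    using enumerate_in_set[OF inf, of n] by auto
  show count: "index_count nv a (?\<kappa> n) = index_count nv a l + n" for n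
  proof -
    have split: "{i. i < ?\<kappa> n \<and> ind_a nv i = a} =
        {i. i < l \<and> ind_a nv i = a} \<union> ?\<kappa> ` {..<n}"
    proof (rule Set.set_eqI, rule iffI)
      fix i assume i: "i \<in> {i. i < ?\<kappa> n \<and> ind_a nv i = a}"
      show "i \<in> {i. i < l \<and> ind_a nv i = a} \<union> ?\<kappa> ` {..<n}"
      proof (cases "i < l")
        case False
        then have "i \<in> range ?\<kappa>" using i by (simp add: range)
        then obtain m where "i = ?\<kappa> m" by blast
        then show ?thesis using i strict_mono_less[OF mono] by auto
      qed (use i in auto)
    next
      fix i assume "i \<in> {i. i < l \<and> ind_a nv i = a} \<union> ?\<kappa> ` {..<n}"
      then show "i \<in> {i. i < ?\<kappa> n \<and> ind_a nv i = a}"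
        using less_le_trans[OF _ mem(1)[of n]] mem strict_mono_less[OF mono] by auto
    qed
    have "card (?\<kappa> ` {..<n}) = n"
      using strict_mono_imp_inj_on[OF mono] by (subst card_image) (auto intro: inj_on_subset)
    moreover have "{i. i < l \<and> ind_a nv i = a} \<inter> ?\<kappa> ` {..<n} = {}"
      using mem by (force simp: not_less[symmetric])
    ultimately show ?thesis
      unfolding index_count_def split by (subst card_Un_disjoint) auto
  qed
  show "chi_exp nv (?\<kappa> n) = edge_exp nv a l + side a * int n" for n
    using chi_exp_eq_edge_exp[OF nv, of "?\<kappa> n"] a count[of n]
    by (auto simp: edge_exp_def side_def mem)
qed

section \<open>Trigonometric moments\<close>

text \<open>
  \<open>h\<close> is a density with respect to \<open>M\<close>, such as the exponential of the potential or one of its factors.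
\<close>

definition circle_moment :: "complex measure \<Rightarrow> (complex \<Rightarrow> complex) \<Rightarrow> int \<Rightarrow> complex" where
  "circle_moment M h k = (LINT u|M. u powi k * h u)"

abbreviation moment :: "complex measure \<Rightarrow> (nat \<Rightarrow> nat \<Rightarrow> complex) \<Rightarrow> int \<Rightarrow> complex" where
  "moment M t \<equiv> circle_moment M (\<lambda>u. exp (potential t u))"

definition circle_bounded :: "complex measure \<Rightarrow> (complex \<Rightarrow> complex) \<Rightarrow> bool" where
  "circle_bounded M h \<longleftrightarrow> h \<in> borel_measurable borel \<and> (\<exists>H. AE u in M. norm (h u) \<le> H)"

lemma powi_measurable [measurable]: "(\<lambda>u::complex. u powi k) \<in> borel_measurable borel"
  by (cases "k \<ge> 0") (simp_all add: power_int_def)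

lemma potential_measurable [measurable]: "potential t \<in> borel_measurable borel"
proof -
  have "(\<lambda>u. potential t u) \<in> borel_measurable borel"
    unfolding potential_def by measurable
  then show ?thesis by simp
qed

lemma unit_norm_powi: "norm (u::complex) = 1 \<Longrightarrow> norm (u powi k) = 1"
  by (simp add: norm_power_int)

lemma unit_cnj_powi:
  assumes "norm (u::complex) = 1"
  shows "cnj (u powi k) = u powi (- k)"
proof -
  have "u * cnj u = 1" using assms by (simp add: complex_norm_square[symmetric])
  then have "cnj u = inverse u" by (metis inverse_unique)
  then show ?thesis by (simp add: power_int_inverse power_int_minus)
qed

context
  fixes M :: "complex measure"
  assumes M: "circle_measure M"
begin

lemma circle_borel_measurable: "borel_measurable M = (borel_measurable borel :: (complex \<Rightarrow> complex) set)"
  using M by (intro measurable_cong_sets) (auto simp: circle_measure_def)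

lemma AE_circle: "AE u in M. norm u = 1"
proof (rule AE_I)
  show "{u \<in> space M. norm u \<noteq> 1} \<subseteq> - sphere 0 1" by auto
  show "emeasure M (- sphere 0 1) = 0" using M by (simp add: circle_measure_def)
  show "- sphere 0 1 \<in> sets M" using M by (auto simp: circle_measure_def intro: borel_open)
qed

lemma integral_circle_cong:
  assumes "f \<in> borel_measurable borel" "g \<in> borel_measurable borel"
    and "\<And>u. norm u = 1 \<Longrightarrow> f u = g u"
  shows "(LINT u|M. f u) = (LINT u|M. g u :: complex)"
  by (rule integral_cong_AE)
     (use assms AE_circle in \<open>auto simp: circle_borel_measurable elim: eventually_mono\<close>)

lemma circle_bounded_integrable:
  assumes "circle_bounded M h"
  shows "integrable M h"
proof -
  interpret finite_measure M using M by (simp add: circle_measure_def)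
  obtain H where "AE u in M. norm (h u) \<le> H" using assms by (auto simp: circle_bounded_def)
  then show ?thesis
    by (rule integrable_const_bound) (use assms in \<open>simp add: circle_bounded_def circle_borel_measurable\<close>)
qed

lemma circle_bounded_powi_mult:
  assumes "circle_bounded M h"
  shows "circle_bounded M (\<lambda>u. u powi k * h u)"
proof -
  obtain H where "AE u in M. norm (h u) \<le> H" using assms by (auto simp: circle_bounded_def)
  then have "AE u in M. norm (u powi k * h u) \<le> H"
    using AE_circle by eventually_elim (simp add: norm_mult unit_norm_powi)
  then show ?thesis using assms by (auto simp: circle_bounded_def)
qed

text \<open>
  Multiplying the density by an absolutely convergent series in \<open>u\<close> or \<open>1/u\<close> forms the corresponding
  series of translates of the moment sequence.
\<close>

lemma circle_moment_mult_series:
  assumes h: "circle_bounded M h" and f: "f \<in> borel_measurable borel"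
    and a: "summable (\<lambda>j. norm (a j))"
    and sums: "\<And>u. norm u = 1 \<Longrightarrow> (\<lambda>j. a j * u powi (s * int j)) sums f u"
  shows "(\<lambda>j. a j * circle_moment M h (k + s * int j)) sums circle_moment M (\<lambda>u. h u * f u) k"
    and "circle_bounded M (\<lambda>u. h u * f u)"
proof -
  interpret finite_measure M using M by (simp add: circle_measure_def)
  have hm: "h \<in> borel_measurable borel" using h by (simp add: circle_bounded_def)
  obtain H where H: "AE u in M. norm (h u) \<le> H" using h by (auto simp: circle_bounded_def)
  define g where "g j u = a j * (u powi (k + s * int j) * h u)" for j u
  have g_int: "integrable M (g j)" for j
    unfolding g_def by (intro integrable_mult_right circle_bounded_integrable circle_bounded_powi_mult h)
  have g_bound: "AE u in M. \<forall>j. norm (g j u) \<le> norm (a j) * H"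
    using H AE_circle
    by eventually_elim (auto simp: g_def norm_mult unit_norm_powi intro: mult_left_mono)
  have "(\<lambda>j. integral\<^sup>L M (g j)) sums (LINT u|M. (\<Sum>j. g j u))"
  proof (rule sums_integral[OF g_int])
    show "AE u in M. summable (\<lambda>j. norm (g j u))"
      using g_bound
    proof eventually_elim
      case (elim u)
      show ?case
        by (rule summable_comparison_test'[OF summable_mult2[OF a, of H]]) (use elim in auto)
    qed
    show "summable (\<lambda>j. LINT u|M. norm (g j u))"
    proof (rule summable_comparison_test'[OF summable_mult2[OF a]])
      fix j
      have "(LINT u|M. norm (g j u)) \<le> (LINT u|M. norm (a j) * H)"
        by (rule integral_mono_AE) (use g_int g_bound in auto)
      then show "norm (LINT u|M. norm (g j u)) \<le> norm (a j) * (H * measure M (space M))"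
        by (simp add: mult_ac integral_nonneg_AE)
    qed
  qed
  moreover have "(LINT u|M. (\<Sum>j. g j u)) = (LINT u|M. u powi k * (h u * f u))"
  proof (rule integral_circle_cong)
    show "(\<lambda>u. \<Sum>j. g j u) \<in> borel_measurable borel" "(\<lambda>u. u powi k * (h u * f u)) \<in> borel_measurable borel"
      unfolding g_def using hm f by measurable
    fix u :: complex assume u: "norm u = 1"
    then have "u \<noteq> 0" by auto
    have "(\<lambda>j. u powi k * h u * (a j * u powi (s * int j))) sums (u powi k * h u * f u)"
      by (intro sums_mult sums u)
    also have "(\<lambda>j. u powi k * h u * (a j * u powi (s * int j))) = (\<lambda>j. g j u)"
      using \<open>u \<noteq> 0\<close> by (auto simp: g_def power_int_add)
    finally show "(\<Sum>j. g j u) = u powi k * (h u * f u)" by (simp add: sums_iff mult_ac)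
  qed
  moreover have "integral\<^sup>L M (g j) = a j * circle_moment M h (k + s * int j)" for j
  proof -
    have "g j = (\<lambda>u. a j * (u powi (k + s * int j) * h u))" by (simp add: g_def fun_eq_iff)
    then show ?thesis by (simp add: circle_moment_def)
  qed
  ultimately show "(\<lambda>j. a j * circle_moment M h (k + s * int j)) sums circle_moment M (\<lambda>u. h u * f u) k"
    by (simp add: circle_moment_def)
  have f_bound: "norm (f u) \<le> (\<Sum>j. norm (a j))" if "norm u = 1" for u
  proof -
    have eq: "norm (a j * u powi (s * int j)) = norm (a j)" for j
      using that by (simp add: norm_mult unit_norm_powi)
    have "norm (\<Sum>j. a j * u powi (s * int j)) \<le> (\<Sum>j. norm (a j * u powi (s * int j)))"
      by (rule summable_norm) (simp add: eq a)
    then show ?thesis using sums[OF that] by (simp add: eq sums_iff)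
  qed
  have "AE u in M. norm (h u * f u) \<le> H * (\<Sum>j. norm (a j))"
    using H AE_circle
    by eventually_elim
       (auto simp: norm_mult intro!: mult_mono f_bound order_trans[OF norm_ge_zero])
  then show "circle_bounded M (\<lambda>u. h u * f u)"
    using hm f by (auto simp: circle_bounded_def)
qed

text \<open>
  If \<open>h\<close> has moments of size \<open>O(r\<^sup>k)\<close> for all integers \<open>k\<close>, then the translates in the preceding series
  are \<open>O(r\<^sup>k r\<^sup>s\<^sup>j)\<close>, and the entire series converges at \<open>r\<^sup>s\<close>.
\<close>

lemma circle_moment_mult_entire_bound:
  assumes h: "circle_bounded M h" and f: "f \<in> borel_measurable borel"
    and a: "\<And>x. x \<ge> 0 \<Longrightarrow> summable (\<lambda>j. norm (a j) * x ^ j)"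
    and sums: "\<And>u. norm u = 1 \<Longrightarrow> (\<lambda>j. a j * u powi (s * int j)) sums f u"
    and r: "r > 0" and C: "\<And>k. norm (circle_moment M h k) \<le> C * r powi k"
  obtains C' where "\<And>k. norm (circle_moment M (\<lambda>u. h u * f u) k) \<le> C' * r powi k"
proof
  fix k
  have "summable (\<lambda>j. norm (a j))" using a[of 1] by simp
  note series = circle_moment_mult_series(1)[OF h f this sums, where k = k]
  have bound: "norm (a j * circle_moment M h (k + s * int j)) \<le>
      C * r powi k * (norm (a j) * (r powi s) ^ j)" for j
  proof -
    have "norm (a j * circle_moment M h (k + s * int j)) \<le> norm (a j) * (C * r powi (k + s * int j))"
      unfolding norm_mult by (intro mult_left_mono C) simp
    also have "r powi (k + s * int j) = r powi k * (r powi s) ^ j"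
      using r by (simp add: power_int_add power_int_mult)
    finally show ?thesis by (simp add: mult_ac)
  qed
  have summ: "summable (\<lambda>j. C * r powi k * (norm (a j) * (r powi s) ^ j))"
    using r by (intro summable_mult a) simp
  have "norm (circle_moment M (\<lambda>u. h u * f u) k) \<le> (\<Sum>j. C * r powi k * (norm (a j) * (r powi s) ^ j))"
    using norm_suminf_le[OF bound summ] series by (simp add: sums_iff)
  also have "\<dots> = C * (\<Sum>j. norm (a j) * (r powi s) ^ j) * r powi k"
    using r by (subst suminf_mult) (auto intro!: a)
  finally show "norm (circle_moment M (\<lambda>u. h u * f u) k) \<le> C * (\<Sum>j. norm (a j) * (r powi s) ^ j) * r powi k" .
qed

end

lemma entire_series_abs_summable:
  fixes c :: "nat \<Rightarrow> complex"
  assumes "\<And>v. summable (\<lambda>j. c j * v ^ j)" and "x \<ge> 0"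
  shows "summable (\<lambda>j. norm (c j) * x ^ j)"
proof -
  have "summable (\<lambda>j. norm (c j * of_real x ^ j))"
    by (rule powser_insidea[OF assms(1), of _ "of_real (x + 1)"]) (use assms(2) in \<open>simp del: of_real_add\<close>)
  then show ?thesis using assms(2) by (simp add: norm_mult norm_power)
qed

text \<open>
  The exponential of an entire function is entire, so its Taylor series converges everywhere.
\<close>

lemma exp_entire_series:
  fixes c :: "nat \<Rightarrow> complex"
  assumes c: "\<And>v. summable (\<lambda>j. c j * v ^ Suc j)"
  obtains a where "\<And>v. (\<lambda>n. a n * v ^ n) sums exp (\<Sum>j. c j * v ^ Suc j)"
    "\<And>x. x \<ge> 0 \<Longrightarrow> summable (\<lambda>n. norm (a n) * x ^ n)"
proof
  have c0: "summable (\<lambda>j. c j * v ^ j)" for v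
  proof (cases "v = 0")
    case False
    then have "(\<lambda>j. c j * v ^ j) = (\<lambda>j. c j * v ^ Suc j / v)" by auto
    then show ?thesis using summable_divide[OF c, of v v] by simp
  qed simp
  let ?P = "\<lambda>v. \<Sum>j. c j * v ^ Suc j"
  have P: "?P v = v * eval_fps (Abs_fps c) v" for v
    using suminf_mult[OF c0, of v v] by (simp add: eval_fps_def mult_ac)
  have "conv_radius c = \<infinity>"
    by (rule conv_radius_inftyI''[of c]) (rule c0)
  then have "fps_conv_radius (Abs_fps c) = \<infinity>"
    by (simp add: fps_conv_radius_def fps_nth_Abs_fps[abs_def])
  then have hol: "(\<lambda>v. exp (?P v)) holomorphic_on UNIV"
    unfolding P by (intro holomorphic_intros) auto
  let ?a = "\<lambda>n. (deriv ^^ n) (\<lambda>v. exp (?P v)) 0 / fact n"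
  show sums: "(\<lambda>n. ?a n * v ^ n) sums exp (?P v)" for v
    using holomorphic_power_series[of "\<lambda>v. exp (?P v)" 0 "norm v + 1" v]
      holomorphic_on_subset[OF hol subset_UNIV] by simp
  show "summable (\<lambda>n. norm (?a n) * x ^ n)" if "x \<ge> 0" for x
    by (rule entire_series_abs_summable[OF _ that]) (use sums in \<open>auto simp: sums_iff\<close>)
qed

lemma entire_parameters_summable:
  assumes "entire_parameters t" "a = 1 \<or> a = 2"
  shows "summable (\<lambda>j. t a (Suc j) * u ^ Suc j)"
  using assms by (auto simp: entire_parameters_def)

lemma potential_eq:
  "potential t u = (\<Sum>j. t 1 (Suc j) * u ^ Suc j - t 2 (Suc j) * inverse u ^ Suc j)"
  unfolding potential_def by (simp only: power_int_minus power_int_of_nat power_inverse)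

lemma potential_sums:
  assumes t: "entire_parameters t"
  shows "(\<lambda>j. t 1 (Suc j) * u ^ Suc j - t 2 (Suc j) * inverse u ^ Suc j) sums potential t u"
    and "potential t u = (\<Sum>j. t 1 (Suc j) * u ^ Suc j) - (\<Sum>j. t 2 (Suc j) * inverse u ^ Suc j)"
proof -
  have sums: "(\<lambda>j. t 1 (Suc j) * u ^ Suc j - t 2 (Suc j) * inverse u ^ Suc j) sums
      ((\<Sum>j. t 1 (Suc j) * u ^ Suc j) - (\<Sum>j. t 2 (Suc j) * inverse u ^ Suc j))"
    by (intro sums_diff summable_sums entire_parameters_summable[OF t]) auto
  then show pot: "potential t u =
      (\<Sum>j. t 1 (Suc j) * u ^ Suc j) - (\<Sum>j. t 2 (Suc j) * inverse u ^ Suc j)"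
    unfolding potential_eq by (simp only: sums_iff)
  show "(\<lambda>j. t 1 (Suc j) * u ^ Suc j - t 2 (Suc j) * inverse u ^ Suc j) sums potential t u"
    unfolding pot by (rule sums)
qed

text \<open>
  The shift of the potential is a logarithm series; hence the exponential of the potential is
  multiplied or divided by a linear factor.
\<close>

lemma miwa_series:
  assumes "norm (x::complex) < 1"
  shows "(\<lambda>j. x ^ Suc j / of_nat (Suc j)) sums (- ln (1 - x))"
proof -
  have "(\<lambda>n. - (x ^ n) / of_nat n) sums ln (1 - x)"
    using Ln_series'[of "- x"] assms by simp
  then have "(\<lambda>n. x ^ n / of_nat n) sums (- ln (1 - x))"
    using sums_minus by fastforce
  then show ?thesis by (subst sums_Suc_iff) simp
qed

lemma exp_ln_one_minus: "norm (x::complex) < 1 \<Longrightarrow> exp (ln (1 - x)) = 1 - x"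
  by (rule exp_Ln) auto

lemma exp_potential_miwa:
  assumes t: "entire_parameters t" and u: "norm u = 1" and w: "norm w < 1"
  shows "exp (potential (miwa_plus t 1 w) u) = exp (potential t u) * (1 / (1 - w * u))"
    and "exp (potential (miwa_minus t 1 w) u) = exp (potential t u) * (1 - w * u)"
    and "exp (potential (miwa_plus t 2 w) u) = exp (potential t u) * (1 - w * inverse u)"
    and "exp (potential (miwa_minus t 2 w) u) = exp (potential t u) * (1 / (1 - w * inverse u))"
proof -
  have n: "norm (w * u) < 1" "norm (w * inverse u) < 1"
    using u w by (auto simp: norm_mult norm_inverse)
  note pot = potential_sums(1)[OF t, of u]
  note s1 = miwa_series[OF n(1)] and s2 = miwa_series[OF n(2)]
  have "(\<lambda>j. miwa_plus t 1 w 1 (Suc j) * u ^ Suc j - miwa_plus t 1 w 2 (Suc j) * inverse u ^ Suc j) sums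
      (potential t u + - ln (1 - w * u))"
    using sums_add[OF pot s1]
    by (simp add: miwa_plus_def power_mult_distrib algebra_simps del: of_nat_Suc power_Suc power_inverse)
  then have "potential (miwa_plus t 1 w) u = potential t u + - ln (1 - w * u)"
    unfolding potential_eq by (simp only: sums_iff)
  then show "exp (potential (miwa_plus t 1 w) u) = exp (potential t u) * (1 / (1 - w * u))"
    by (simp only: exp_add exp_minus exp_ln_one_minus[OF n(1)] divide_inverse mult_1_left)
  have "(\<lambda>j. miwa_minus t 1 w 1 (Suc j) * u ^ Suc j - miwa_minus t 1 w 2 (Suc j) * inverse u ^ Suc j) sums
      (potential t u - - ln (1 - w * u))"
    using sums_diff[OF pot s1]
    by (simp add: miwa_minus_def power_mult_distrib algebra_simps del: of_nat_Suc power_Suc power_inverse)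
  then have "potential (miwa_minus t 1 w) u = potential t u - - ln (1 - w * u)"
    unfolding potential_eq by (simp only: sums_iff)
  then show "exp (potential (miwa_minus t 1 w) u) = exp (potential t u) * (1 - w * u)"
    by (simp only: exp_diff exp_minus exp_ln_one_minus[OF n(1)] divide_inverse inverse_inverse_eq)
  have "(\<lambda>j. miwa_plus t 2 w 1 (Suc j) * u ^ Suc j - miwa_plus t 2 w 2 (Suc j) * inverse u ^ Suc j) sums
      (potential t u - - ln (1 - w * inverse u))"
    using sums_diff[OF pot s2]
    by (simp add: miwa_plus_def power_mult_distrib algebra_simps del: of_nat_Suc power_Suc power_inverse)
  then have "potential (miwa_plus t 2 w) u = potential t u - - ln (1 - w * inverse u)"
    unfolding potential_eq by (simp only: sums_iff)
  then show "exp (potential (miwa_plus t 2 w) u) = exp (potential t u) * (1 - w * inverse u)"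
    by (simp only: exp_diff exp_minus exp_ln_one_minus[OF n(2)] divide_inverse inverse_inverse_eq)
  have "(\<lambda>j. miwa_minus t 2 w 1 (Suc j) * u ^ Suc j - miwa_minus t 2 w 2 (Suc j) * inverse u ^ Suc j) sums
      (potential t u + - ln (1 - w * inverse u))"
    using sums_add[OF pot s2]
    by (simp add: miwa_minus_def power_mult_distrib algebra_simps del: of_nat_Suc power_Suc power_inverse)
  then have "potential (miwa_minus t 2 w) u = potential t u + - ln (1 - w * inverse u)"
    unfolding potential_eq by (simp only: sums_iff)
  then show "exp (potential (miwa_minus t 2 w) u) = exp (potential t u) * (1 / (1 - w * inverse u))"
    by (simp only: exp_add exp_minus exp_ln_one_minus[OF n(2)] divide_inverse mult_1_left)
qed

context
  fixes M :: "complex measure" and t :: "nat \<Rightarrow> nat \<Rightarrow> complex"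
  assumes M: "circle_measure M" and t: "entire_parameters t"
begin

text \<open>
  On the circle \<open>exp(potential t u)\<close> is the product of an entire function of \<open>u\<close> and one of \<open>1/u\<close>,
  so a bound of the moments by a two-sided geometric sequence survives the deformation.
\<close>

lemma exp_potential_circle_bounded: "circle_bounded M (\<lambda>u. exp (potential t u))"
  and moment_bound: "r > 0 \<Longrightarrow> (\<And>k. norm (circle_moment M (\<lambda>u. 1) k) \<le> C * r powi k) \<Longrightarrow>
    \<exists>C'. \<forall>k. norm (moment M t k) \<le> C' * r powi k"
proof -
  have s1: "summable (\<lambda>j. t 1 (Suc j) * v ^ Suc j)" for v
    by (rule entire_parameters_summable[OF t]) simp
  have s2: "summable (\<lambda>j. (- t 2 (Suc j)) * v ^ Suc j)" for v
    using summable_minus[OF entire_parameters_summable[OF t, of 2 v]] by simp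
  obtain a where a: "\<And>v. (\<lambda>n. a n * v ^ n) sums exp (\<Sum>j. t 1 (Suc j) * v ^ Suc j)"
    "\<And>x. x \<ge> 0 \<Longrightarrow> summable (\<lambda>n. norm (a n) * x ^ n)"
    using exp_entire_series[OF s1] by blast
  obtain b where b: "\<And>v. (\<lambda>n. b n * v ^ n) sums exp (\<Sum>j. (- t 2 (Suc j)) * v ^ Suc j)"
    "\<And>x. x \<ge> 0 \<Longrightarrow> summable (\<lambda>n. norm (b n) * x ^ n)"
    using exp_entire_series[OF s2] by blast
  define f where "f u = exp (\<Sum>j. t 1 (Suc j) * u ^ Suc j)" for u
  define g where "g u = exp (\<Sum>j. (- t 2 (Suc j)) * inverse u ^ Suc j)" for u
  have factors: "exp (potential t u) = f u * g u" for u
  proof -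
    have "(\<Sum>j. (- t 2 (Suc j)) * inverse u ^ Suc j) = - (\<Sum>j. t 2 (Suc j) * inverse u ^ Suc j)"
      using suminf_minus[OF entire_parameters_summable[OF t, of 2 "inverse u"]] by simp
    then show ?thesis
      using potential_sums(2)[OF t, of u] by (simp add: f_def g_def exp_add[symmetric])
  qed
  have f_sums: "(\<lambda>j. a j * u powi (1 * int j)) sums f u" for u
    using a(1)[of u] by (simp add: f_def)
  have g_sums: "(\<lambda>j. b j * u powi (- 1 * int j)) sums g u" for u
    using b(1)[of "inverse u"] by (simp add: g_def power_int_minus power_inverse)
  have fm: "f \<in> borel_measurable borel" and gm: "g \<in> borel_measurable borel"
    unfolding f_def g_def by measurable
  have one: "circle_bounded M (\<lambda>u. 1)" by (auto simp: circle_bounded_def intro!: exI[of _ 1])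
  have fb: "circle_bounded M (\<lambda>u. 1 * f u)"
    by (rule circle_moment_mult_series(2)[OF M one fm _ f_sums]) (use a(2)[of 1] in simp)
  have eq: "(\<lambda>u. 1 * f u * g u) = (\<lambda>u. exp (potential t u))" by (simp add: factors)
  have "circle_bounded M (\<lambda>u. 1 * f u * g u)"
    by (rule circle_moment_mult_series(2)[OF M fb gm _ g_sums]) (use b(2)[of 1] in simp)
  then show "circle_bounded M (\<lambda>u. exp (potential t u))" unfolding eq .
  show "\<exists>C'. \<forall>k. norm (moment M t k) \<le> C' * r powi k"
    if r: "r > 0" and C: "\<And>k. norm (circle_moment M (\<lambda>u. 1) k) \<le> C * r powi k"
  proof -
    obtain C1 where C1: "\<And>k. norm (circle_moment M (\<lambda>u. 1 * f u) k) \<le> C1 * r powi k"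
      using circle_moment_mult_entire_bound[OF M one fm a(2) f_sums r C] by blast
    obtain C2 where "\<And>k. norm (circle_moment M (\<lambda>u. 1 * f u * g u) k) \<le> C2 * r powi k"
      using circle_moment_mult_entire_bound[OF M fb gm b(2) g_sums r C1] by blast
    then show ?thesis unfolding eq by blast
  qed
qed

end

section \<open>The annulus of convergence\<close>

lemma moment_undeformed: "moment M (\<lambda>_ _. 0) = circle_moment M (\<lambda>u. 1)"
  by (simp add: potential_def)

lemma fourier_coeff_eq_moment: "fourier_coeff M t n = moment M t (- n) / (2 * of_real pi)"
  by (simp add: fourier_coeff_def circle_integral_def circle_moment_def)

context
  fixes M :: "complex measure"
  assumes M: "circle_measure M"
begin

lemma circle_moment_one_uminus:
  "circle_moment M (\<lambda>u. 1) (- k) = cnj (circle_moment M (\<lambda>u. 1) k)"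
proof -
  have "circle_moment M (\<lambda>u. 1) (- k) = (LINT u|M. cnj (u powi k * 1))"
    unfolding circle_moment_def
  proof (rule integral_circle_cong[OF M])
    show "(\<lambda>u. cnj (u powi k * 1)) \<in> borel_measurable borel"
      by (rule borel_measurable_continuous_on[OF continuous_on_cnj[OF continuous_on_id]]) simp
  qed (simp_all add: unit_cnj_powi del: complex_cnj_power_int)
  then show ?thesis by (simp only: circle_moment_def Bochner_Integration.integral_cnj)
qed

lemma R_minus_nonneg: "R_minus M \<ge> 0"
  unfolding R_minus_def by (rule le_Limsup) (auto simp: zero_ereal_def intro!: always_eventually real_root_ge_zero)

text \<open>The Fourier coefficients of a positive measure are Hermitian, so both radii come from one sequence.\<close>

lemma R_plus_eq: "R_plus M = inverse (R_minus M)"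
proof -
  have "norm (fourier_coeff M (\<lambda>_ _. 0) (int n)) = norm (fourier_coeff M (\<lambda>_ _. 0) (- int n))" for n
    using circle_moment_one_uminus[of "int n"]
    unfolding fourier_coeff_eq_moment moment_undeformed by (simp add: norm_divide)
  then show ?thesis by (simp add: R_plus_def R_minus_def)
qed

lemma inverse_R_plus: "inverse (R_plus M) = R_minus M"
  unfolding R_plus_eq using R_minus_nonneg by (cases "R_minus M") auto

lemma inverse_radius:
  assumes "R_minus M < ereal x"
  shows "0 < x" "ereal (inverse x) < inverse (R_minus M)"
proof -
  show "0 < x" using R_minus_nonneg assms by (metis ereal_less(2) le_less_trans)
  then show "ereal (inverse x) < inverse (R_minus M)"
    using assms R_minus_nonneg by (cases "R_minus M") auto
qed

lemma annulus_radii: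
  fixes z :: complex
  assumes "R_minus M < ereal (norm z)" "ereal (norm z) < R_plus M"
  shows "z \<noteq> 0" "ereal (norm (inverse z)) < inverse (R_minus M)"
    "ereal (norm z) < inverse (R_minus M)"
  using inverse_radius[OF assms(1)] assms(2) by (auto simp: norm_inverse R_plus_eq)

text \<open>
  The \<open>limsup\<close> bounds the moments on one side for \<open>r > R\<^sub>-\<close>, and the symmetry of the moments gives the
  other side. Since \<open>r \<le> 1\<close>, the resulting bound by \<open>r\<^bsup>|k|\<^esup>\<close> implies both bounds claimed. The case \<open>r = 1\<close> is
  the trivial bound by the total mass, which also holds when \<open>R\<^sub>- = 1\<close>.
\<close>

lemma undeformed_moment_bound:
  assumes r: "0 < r" "r \<le> 1" and R: "R_minus M < ereal r \<or> r = 1"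
  obtains C where "\<And>k. norm (circle_moment M (\<lambda>u. 1) k) \<le> C * r powi k"
    "\<And>k. norm (circle_moment M (\<lambda>u. 1) k) \<le> C * r powi (- k)"
proof -
  let ?m = "circle_moment M (\<lambda>u. 1)"
  interpret finite_measure M using M by (simp add: circle_measure_def)
  have one: "circle_bounded M (\<lambda>u. 1)" by (auto simp: circle_bounded_def intro!: exI[of _ 1])
  define B where "B = measure M (space M)"
  have B: "norm (?m k) \<le> B" for k
  proof -
    have "norm (?m k) \<le> (LINT u|M. norm (u powi k * 1))"
      unfolding circle_moment_def by (rule integral_norm_bound)
    also have "\<dots> \<le> (LINT u|M. 1)"
    proof (rule integral_mono_AE)
      show "integrable M (\<lambda>u. norm (u powi k * 1))"
        by (intro integrable_norm circle_bounded_integrable circle_bounded_powi_mult M one)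
      show "AE u in M. norm (u powi k * 1) \<le> (1::real)"
        using AE_circle[OF M] by eventually_elim (simp add: unit_norm_powi)
    qed simp
    finally show ?thesis by (simp add: B_def)
  qed
  have "B \<ge> 0" by (simp add: B_def)
  have "\<exists>C\<ge>0. \<forall>n. norm (?m (int n)) \<le> C * r ^ n"
  proof (cases "r = 1")
    case True
    then show ?thesis using B \<open>B \<ge> 0\<close> by auto
  next
    case False
    then have "R_minus M < ereal r" using R by simp
    then have "eventually (\<lambda>n. ereal (root n (norm (fourier_coeff M (\<lambda>_ _. 0) (- int n)))) < ereal r)
        sequentially"
      unfolding R_minus_def by (rule Limsup_lessD)
    then obtain n0 where n0: "\<And>n. n \<ge> n0 \<Longrightarrow> root n (norm (fourier_coeff M (\<lambda>_ _. 0) (- int n))) < r"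
      unfolding eventually_sequentially by auto
    have tail: "norm (?m (int n)) \<le> 2 * pi * r ^ n" if "n \<ge> Suc n0" for n
    proof -
      let ?c = "norm (fourier_coeff M (\<lambda>_ _. 0) (- int n))"
      have "?c = root n ?c ^ n" using that by simp
      also have "\<dots> \<le> r ^ n"
        by (rule power_mono) (use n0[of n] that in \<open>auto intro: real_root_ge_zero\<close>)
      finally have "?c \<le> r ^ n" .
      then show ?thesis
        unfolding fourier_coeff_eq_moment moment_undeformed by (simp add: norm_divide norm_mult field_simps)
    qed
    have head: "norm (?m (int n)) \<le> B / r ^ n0 * r ^ n" if "n \<le> n0" for n
    proof -
      have "r ^ n0 \<le> r ^ n" by (rule power_decreasing) (use that r in auto)
      then have "1 \<le> r ^ n / r ^ n0" using r by simp
      from mult_left_mono[OF this \<open>B \<ge> 0\<close>] have "B \<le> B * (r ^ n / r ^ n0)" by simp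
      then show ?thesis using B[of "int n"] by simp
    qed
    have "norm (?m (int n)) \<le> (2 * pi + B / r ^ n0) * r ^ n" for n
    proof (cases "n \<le> n0")
      case True
      have "0 \<le> 2 * pi * r ^ n" using r by simp
      then show ?thesis using head[OF True] by (simp add: distrib_right)
    next
      case False
      have "0 \<le> B / r ^ n0 * r ^ n" using r \<open>B \<ge> 0\<close> by simp
      then show ?thesis using tail[of n] False unfolding distrib_right by simp
    qed
    moreover have "2 * pi + B / r ^ n0 \<ge> 0" using r \<open>B \<ge> 0\<close> by simp
    ultimately show ?thesis by blast
  qed
  then obtain C where C: "C \<ge> 0" "\<And>n. norm (?m (int n)) \<le> C * r ^ n" by blast
  have both: "norm (?m k) \<le> C * r powi (int (nat \<bar>k\<bar>))" for k
  proof -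
    have "norm (?m (int (nat \<bar>k\<bar>))) = norm (?m k)"
      using circle_moment_one_uminus[of k] by (cases "k \<ge> 0") auto
    then show ?thesis using C(2)[of "nat \<bar>k\<bar>"] by (simp only: power_int_of_nat)
  qed
  have mono: "r powi int (nat \<bar>k\<bar>) \<le> r powi k" "r powi int (nat \<bar>k\<bar>) \<le> r powi (- k)" for k
    by (rule power_int_decreasing; use r in simp)+
  show thesis
  proof
    fix k
    show "norm (?m k) \<le> C * r powi k"
      by (rule order_trans[OF both mult_left_mono[OF mono(1) C(1)]])
    show "norm (?m k) \<le> C * r powi (- k)"
      by (rule order_trans[OF both mult_left_mono[OF mono(2) C(1)]])
  qed
qed

context
  fixes t :: "nat \<Rightarrow> nat \<Rightarrow> complex"
  assumes t: "entire_parameters t"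
begin

lemma two_sided_moment_bound:
  assumes r: "0 < r" "r \<le> 1" and R: "R_minus M < ereal r \<or> r = 1"
  obtains C where "\<And>k. norm (moment M t k) \<le> C * r powi k"
    "\<And>k. norm (moment M t k) \<le> C * r powi (- k)"
proof -
  obtain C where C: "\<And>k. norm (circle_moment M (\<lambda>u. 1) k) \<le> C * r powi k"
    "\<And>k. norm (circle_moment M (\<lambda>u. 1) k) \<le> C * r powi (- k)"
    using undeformed_moment_bound[OF r R] by blast
  obtain C1 where C1: "\<forall>k. norm (moment M t k) \<le> C1 * r powi k"
    using moment_bound[OF M t r(1) C(1)] by blast
  have "norm (circle_moment M (\<lambda>u. 1) k) \<le> C * (inverse r) powi k" for k
    using C(2)[of k] by (simp add: power_int_minus power_int_inverse)
  then obtain C2 where C2: "\<forall>k. norm (moment M t k) \<le> C2 * (inverse r) powi k"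
    using moment_bound[OF M t, of "inverse r" C] r by auto
  show thesis
  proof
    fix k
    have "norm (moment M t k) \<le> C1 * r powi k" using C1 by blast
    also have "\<dots> \<le> max C1 C2 * r powi k" using r by (intro mult_right_mono) auto
    finally show "norm (moment M t k) \<le> max C1 C2 * r powi k" .
    have "norm (moment M t k) \<le> C2 * r powi (- k)"
      using C2[THEN spec, of k] by (simp add: power_int_minus power_int_inverse)
    also have "\<dots> \<le> max C1 C2 * r powi (- k)" using r by (intro mult_right_mono) auto
    finally show "norm (moment M t k) \<le> max C1 C2 * r powi (- k)" .
  qed
qed

text \<open>
  The disjunct \<open>x < 1\<close> lets the same lemma serve the unit disc, where the Miwa shifts are defined,
  and the larger disc of the continuation.
\<close>

lemma moment_series_summable:
  assumes x: "0 \<le> x" and R: "x < 1 \<or> ereal x < inverse (R_minus M)" and s: "s = 1 \<or> s = - 1"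
  shows "summable (\<lambda>n. norm (moment M t (c + s * int n)) * x ^ n)"
proof -
  obtain r where r: "0 < r" "r \<le> 1" "R_minus M < ereal r \<or> r = 1" "r * x < 1"
  proof (cases "x < 1")
    case True
    show thesis by (rule that[of 1]) (use True in auto)
  next
    case False
    then have x1: "x \<ge> 1" "ereal x < inverse (R_minus M)" using R by auto
    then obtain \<rho> where \<rho>: "R_minus M = ereal \<rho>" "\<rho> \<ge> 0"
      using R_minus_nonneg by (cases "R_minus M") auto
    have "\<rho> < 1 / x"
      using x1 \<rho> by (cases "\<rho> = 0") (auto simp: field_simps)
    moreover have "1 / x \<le> 1" using x1 by simp
    ultimately show thesis
      using \<rho> x1 by (intro that[of "(\<rho> + 1 / x) / 2"]) (auto simp: field_simps add_pos_nonneg)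
  qed
  obtain C where C: "\<And>k. norm (moment M t k) \<le> C * r powi k"
    "\<And>k. norm (moment M t k) \<le> C * r powi (- k)"
    using two_sided_moment_bound[OF r(1-3)] by blast
  have bound: "norm (moment M t (c + s * int n)) * x ^ n \<le> C * r powi (s * c) * (r * x) ^ n" for n
  proof -
    have "norm (moment M t (c + s * int n)) \<le> C * r powi (s * (c + s * int n))"
      using s C(1)[of "c + s * int n"] C(2)[of "c + s * int n"] by auto
    also have "s * (c + s * int n) = s * c + int n" using s by (auto simp: algebra_simps)
    also have "r powi (s * c + int n) = r powi (s * c) * r ^ n" using r by (simp add: power_int_add)
    finally have "norm (moment M t (c + s * int n)) * x ^ n \<le> C * (r powi (s * c) * r ^ n) * x ^ n"
      using x by (intro mult_right_mono) auto
    then show ?thesis by (simp add: power_mult_distrib mult_ac)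
  qed
  have "summable (\<lambda>n. C * r powi (s * c) * (r * x) ^ n)"
    using r x by (intro summable_mult summable_geometric) auto
  then show ?thesis
    by (rule summable_comparison_test') (use bound x in auto)
qed

end

end

context
  fixes M :: "complex measure" and t :: "nat \<Rightarrow> nat \<Rightarrow> complex" and z :: complex
  assumes M: "circle_measure M" and t: "entire_parameters t"
    and z1: "R_minus M < ereal (norm z)" and z2: "ereal (norm z) < R_plus M"
begin

lemma two_sided_moment_series:
  "(\<lambda>k. z powi (- k) * moment M t k) summable_on UNIV"
proof -
  let ?S = "\<lambda>k. z powi (- k) * moment M t k"
  have half: "?S summable_on range (\<lambda>n::nat. c + s * int n)"
    if s: "s = 1 \<or> s = - 1" and w: "ereal (norm (z powi (- s))) < inverse (R_minus M)" for c s
  proof -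
    have inj: "inj (\<lambda>n::nat. c + s * int n)" using s by (auto intro: injI)
    have eq: "norm (?S (c + s * int n)) =
        norm (z powi (- c)) * (norm (moment M t (c + s * int n)) * norm (z powi (- s)) ^ n)" for n
    proof -
      have "z powi (- (c + s * int n)) = z powi (- c) * z powi ((- s) * int n)"
        using annulus_radii(1)[OF M z1 z2] by (simp add: power_int_add[symmetric])
      also have "z powi ((- s) * int n) = (z powi (- s)) ^ n"
        by (simp only: power_int_mult power_int_of_nat)
      finally show ?thesis by (simp add: norm_mult norm_power)
    qed
    have "summable (\<lambda>n. norm (?S (c + s * int n)))"
      unfolding eq by (intro summable_mult moment_series_summable[OF M t] s disjI2 w) simp
    then have "(\<lambda>n. ?S (c + s * int n)) summable_on UNIV"
      by (rule norm_summable_imp_summable_on)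
    then show ?thesis using summable_on_reindex[OF inj, of ?S] by (simp add: o_def)
  qed
  have "?S summable_on (range (\<lambda>n::nat. 0 + 1 * int n) \<union> range (\<lambda>n::nat. 0 + - 1 * int n))"
    by (intro summable_on_union half) (use annulus_radii[OF M z1 z2] in \<open>auto simp: power_int_minus norm_inverse\<close>)
  also have "range (\<lambda>n::nat. 0 + 1 * int n) \<union> range (\<lambda>n::nat. 0 + - 1 * int n) = UNIV"
  proof (intro equalityI subsetI UnCI)
    fix k :: int assume "k \<notin> range (\<lambda>n::nat. 0 + - 1 * int n)"
    moreover have "k \<in> range (\<lambda>n::nat. 0 + - 1 * int n)" if "k \<le> 0"
      using that by (intro image_eqI[of _ _ "nat (- k)"]) auto
    ultimately have "k > 0" by force
    then show "k \<in> range (\<lambda>n::nat. 0 + 1 * int n)" by (intro image_eqI[of _ _ "nat k"]) auto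
  qed auto
  finally show ?thesis .
qed

lemma fourier_series_summable: "(\<lambda>n. fourier_coeff M t n * z powi n) summable_on UNIV"
  and fourier_series_has_sum:
    "((\<lambda>k. z powi (- k) * moment M t k) has_sum (2 * of_real pi * fourier_series M t z)) UNIV"
    "((\<lambda>k. inverse z powi (- k) * moment M t (- k)) has_sum (2 * of_real pi * fourier_series M t z)) UNIV"
proof -
  let ?\<Phi> = "\<Sum>\<^sub>\<infinity>k. z powi (- k) * moment M t k"
  have sum: "((\<lambda>k. z powi (- k) * moment M t k) has_sum ?\<Phi>) UNIV"
    using two_sided_moment_series by simp
  moreover have "((\<lambda>k. z powi (- k) * moment M t k) has_sum ?\<Phi>) UNIV \<longleftrightarrow>
      ((\<lambda>k. inverse z powi (- k) * moment M t (- k)) has_sum ?\<Phi>) UNIV"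
    by (rule has_sum_reindex_bij_witness[of _ uminus uminus])
       (auto simp: power_int_minus power_int_inverse)
  ultimately have refl: "((\<lambda>k. inverse z powi (- k) * moment M t (- k)) has_sum ?\<Phi>) UNIV" by blast
  have "(\<lambda>n. fourier_coeff M t n * z powi n) =
      (\<lambda>k. 1 / (2 * of_real pi) * (inverse z powi (- k) * moment M t (- k)))"
    by (auto simp: fourier_coeff_eq_moment power_int_minus power_int_inverse)
  then have F: "((\<lambda>n. fourier_coeff M t n * z powi n) has_sum (1 / (2 * of_real pi) * ?\<Phi>)) UNIV"
    using has_sum_cmult_right[OF refl, of "1 / (2 * of_real pi)"] by (simp only:)
  then show "(\<lambda>n. fourier_coeff M t n * z powi n) summable_on UNIV" by (rule has_sum_imp_summable)
  have "2 * of_real pi * fourier_series M t z = ?\<Phi>"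
    unfolding fourier_series_def infsumI[OF F] by simp
  then show "((\<lambda>k. z powi (- k) * moment M t k) has_sum (2 * of_real pi * fourier_series M t z)) UNIV"
    "((\<lambda>k. inverse z powi (- k) * moment M t (- k)) has_sum (2 * of_real pi * fourier_series M t z)) UNIV"
    using sum refl by simp_all
qed

end

section \<open>Miwa shifts of the moments\<close>

context
  fixes M :: "complex measure" and t :: "nat \<Rightarrow> nat \<Rightarrow> complex" and w :: complex
  assumes M: "circle_measure M" and t: "entire_parameters t" and w: "norm w < 1"
begin

lemma moment_geometric_factor:
  assumes s: "s = 1 \<or> s = - 1"
    and t': "\<And>u. norm u = 1 \<Longrightarrow> exp (potential t' u) = exp (potential t u) * (1 / (1 - w * u powi s))"
  shows "(\<lambda>n. w ^ n * moment M t (k + s * int n)) sums moment M t' k"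
proof -
  let ?f = "\<lambda>u. 1 / (1 - w * u powi s)"
  have f: "?f \<in> borel_measurable borel" by measurable
  have "(\<lambda>j. w ^ j * u powi (s * int j)) sums ?f u" if "norm u = 1" for u
  proof -
    have "norm (w * u powi s) < 1" using that w by (simp add: norm_mult unit_norm_powi)
    then have "(\<lambda>j. (w * u powi s) ^ j) sums ?f u" by (rule geometric_sums)
    then show ?thesis by (simp add: power_mult_distrib power_int_mult)
  qed
  from circle_moment_mult_series(1)[OF M exp_potential_circle_bounded[OF M t] f _ this, where k = k]
  have "(\<lambda>n. w ^ n * moment M t (k + s * int n)) sums
      circle_moment M (\<lambda>u. exp (potential t u) * ?f u) k"
    using w by (simp add: norm_power)
  also have "circle_moment M (\<lambda>u. exp (potential t u) * ?f u) k = moment M t' k"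
    unfolding circle_moment_def
    by (rule integral_circle_cong[OF M]) (use t' f in \<open>auto\<close>)
  finally show ?thesis .
qed

lemma moment_linear_factor:
  assumes t': "\<And>u. norm u = 1 \<Longrightarrow> exp (potential t' u) = exp (potential t u) * (1 - w * u powi s)"
  shows "moment M t' k = moment M t k - w * moment M t (k + s)"
proof -
  let ?E = "\<lambda>u. exp (potential t u)"
  have int: "integrable M (\<lambda>u. u powi k * ?E u)" for k
    by (intro circle_bounded_integrable circle_bounded_powi_mult exp_potential_circle_bounded M t)
  have "moment M t' k = (LINT u|M. u powi k * ?E u - w * (u powi (k + s) * ?E u))"
    unfolding circle_moment_def
  proof (rule integral_circle_cong[OF M])
    fix u :: complex assume u: "norm u = 1"
    then have "u \<noteq> 0" by auto
    then show "u powi k * exp (potential t' u) = u powi k * ?E u - w * (u powi (k + s) * ?E u)"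
      unfolding t'[OF u] by (simp add: power_int_add algebra_simps)
  qed auto
  also have "\<dots> = moment M t k - w * moment M t (k + s)"
    unfolding circle_moment_def using int by (subst Bochner_Integration.integral_diff) auto
  finally show ?thesis .
qed

lemma moment_miwa:
  shows "(\<lambda>n. w ^ n * moment M t (k + 1 * int n)) sums moment M (miwa_plus t 1 w) k"
    and "(\<lambda>n. w ^ n * moment M t (k + - 1 * int n)) sums moment M (miwa_minus t 2 w) k"
    and "moment M (miwa_minus t 1 w) k = moment M t k - w * moment M t (k + 1)"
    and "moment M (miwa_plus t 2 w) k = moment M t k - w * moment M t (k + - 1)"
proof -
  note shift = exp_potential_miwa[OF t _ w]
  show "(\<lambda>n. w ^ n * moment M t (k + 1 * int n)) sums moment M (miwa_plus t 1 w) k"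
    by (rule moment_geometric_factor) (simp_all only: shift power_int_1_right, simp)
  show "(\<lambda>n. w ^ n * moment M t (k + - 1 * int n)) sums moment M (miwa_minus t 2 w) k"
    by (rule moment_geometric_factor) (simp_all only: shift power_int_minus1_right, simp)
  show "moment M (miwa_minus t 1 w) k = moment M t k - w * moment M t (k + 1)"
    by (rule moment_linear_factor) (simp only: shift power_int_1_right)
  show "moment M (miwa_plus t 2 w) k = moment M t k - w * moment M t (k + - 1)"
    by (rule moment_linear_factor) (simp only: shift power_int_minus1_right)
qed

end

section \<open>Holomorphic continuation\<close>

lemma continued_eqI:
  assumes D: "open D" "connected D" "0 \<in> D" "w \<in> D"
    and h: "h holomorphic_on D" "\<And>x. norm x < 1 \<Longrightarrow> h x = f x"
  shows "continued f D w = h w"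
  unfolding continued_def
proof (rule the_equality)
  show "\<exists>h'. h' holomorphic_on D \<and> (\<forall>x. norm x < 1 \<longrightarrow> h' x = f x) \<and> h' w = h w"
    using h by blast
next
  fix v assume "\<exists>h'. h' holomorphic_on D \<and> (\<forall>x. norm x < 1 \<longrightarrow> h' x = f x) \<and> h' w = v"
  then obtain h' where h': "h' holomorphic_on D" "\<And>x. norm x < 1 \<Longrightarrow> h' x = f x" "h' w = v"
    by blast
  have "h' w = h w"
  proof (rule analytic_continuation_open[of "D \<inter> ball 0 1" D h' h])
    show "D \<inter> ball 0 1 \<noteq> {}" using D by (auto intro!: exI[of _ 0])
  qed (use D h h' in auto)
  then show "v = h w" using h' by simp
qed

text \<open>
  A power series for \<open>f\<close> on the unit disc that converges up to radius \<open>R\<close> is the continuation of \<open>f\<close>, and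
  the identity theorem leaves no other value.
\<close>

lemma continued_power_series:
  fixes d :: "nat \<Rightarrow> complex"
  assumes f: "\<And>x. norm x < 1 \<Longrightarrow> (\<lambda>n. x ^ n * d n) sums f x"
    and R: "\<And>x. ereal (norm x) < R \<Longrightarrow> summable (\<lambda>n. x ^ n * d n)" and w: "ereal (norm w) < R"
  shows "(\<lambda>n. w ^ n * d n) sums continued f (eball 0 R) w"
proof -
  have R0: "0 < R" using w by (metis ereal_less_eq(5) le_less_trans norm_ge_zero)
  have "conv_radius d \<ge> R"
    by (rule conv_radius_geI_ex') (use R in \<open>simp add: mult.commute\<close>)
  then have "eval_fps (Abs_fps d) holomorphic_on eball 0 R"
    by (intro holomorphic_on_eval_fps eball_mono) (simp add: fps_conv_radius_def fps_nth_Abs_fps[abs_def])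
  moreover have "eval_fps (Abs_fps d) x = f x" if "norm x < 1" for x
    using f[OF that] by (simp add: eval_fps_def sums_iff mult.commute)
  ultimately have "continued f (eball 0 R) w = eval_fps (Abs_fps d) w"
    by (intro continued_eqI) (use w R0 in \<open>auto simp: zero_ereal_def\<close>)
  then show ?thesis using R[OF w] by (simp add: eval_fps_def sums_iff mult.commute)
qed

lemma continued_entire:
  assumes "h holomorphic_on UNIV" "\<And>x. norm x < 1 \<Longrightarrow> f x = h x"
  shows "continued f UNIV w = h w"
  by (rule continued_eqI) (use assms in auto)

section \<open>Bordered moment determinants\<close>

text \<open>
  The leading minor of order \<open>l + 1\<close> of the moment matrix \<open>m (e\<^sub>i - e\<^sub>j)\<close> with its last row moved to the
  exponent \<open>x\<close>. Column versions arise by transposition, which reflects the moment sequence \<open>m\<close>.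
\<close>

definition bordered_minor ::
    "(int \<Rightarrow> complex) \<Rightarrow> nat \<times> nat \<Rightarrow> nat \<Rightarrow> int \<Rightarrow> complex" where
  "bordered_minor m nv l x = minor (Suc l)
     (\<lambda>i j. if i = l then m (x - chi_exp nv j) else m (chi_exp nv i - chi_exp nv j))"

lemma bordered_minor_linear:
  obtains c where "\<And>x. bordered_minor m nv l x = (\<Sum>j\<le>l. c j * m (x - chi_exp nv j))"
    "\<And>y. minor (Suc l) (\<lambda>i j. if i = l then y j else m (chi_exp nv i - chi_exp nv j)) =
      (\<Sum>j\<le>l. c j * y j)"
proof -
  obtain c where "\<forall>y. minor (Suc l) (\<lambda>i j. if i = l then y j else m (chi_exp nv i - chi_exp nv j)) =
      (\<Sum>j\<le>l. c j * y j)"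
    using minor_linear_last_row[of l "\<lambda>i j. m (chi_exp nv i - chi_exp nv j)"] by blast
  then show thesis by (intro that[of c]) (simp_all add: bordered_minor_def)
qed

lemma bordered_minor_summable:
  assumes "\<And>c. summable (\<lambda>n. norm (m (c + s * int n)) * norm w ^ n)"
  shows "summable (\<lambda>n. w ^ n * bordered_minor m nv l (x + s * int n))"
proof -
  obtain c where c: "\<And>x. bordered_minor m nv l x = (\<Sum>j\<le>l. c j * m (x - chi_exp nv j))"
    using bordered_minor_linear by blast
  have "summable (\<lambda>n. \<Sum>j\<le>l. c j * (w ^ n * m (x - chi_exp nv j + s * int n)))"
  proof (intro summable_sum summable_mult)
    fix j
    have "summable (\<lambda>n. norm (w ^ n * m (x - chi_exp nv j + s * int n)))"
      using assms[of "x - chi_exp nv j"] by (simp add: norm_mult norm_power mult.commute)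
    then show "summable (\<lambda>n. w ^ n * m (x - chi_exp nv j + s * int n))"
      by (rule summable_norm_cancel)
  qed
  also have "(\<lambda>n. \<Sum>j\<le>l. c j * (w ^ n * m (x - chi_exp nv j + s * int n))) =
      (\<lambda>n. w ^ n * bordered_minor m nv l (x + s * int n))"
    by (simp add: c(1) sum_distrib_left algebra_simps)
  finally show ?thesis .
qed

lemma has_sum_finite_sum:
  fixes f :: "'a \<Rightarrow> 'b \<Rightarrow> complex"
  assumes "finite A" "\<And>a. a \<in> A \<Longrightarrow> (f a has_sum s a) B"
  shows "((\<lambda>x. \<Sum>a\<in>A. f a x) has_sum (\<Sum>a\<in>A. s a)) B"
  using assms by (induction A rule: finite_induct) (auto intro!: has_sum_add)

lemma chi1_star_cnj: "chi1_star nv (cnj z) k = cnj (chi1_star nv z k)"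
  by (simp add: chi1_star_def chi1_def)

lemma chi2_cnj: "chi2 nv (cnj z) k = cnj (chi2 nv z k)"
  by (simp add: chi2_def)

context
  fixes nv :: "nat \<times> nat"
  assumes nv: "fst nv \<ge> 1" "snd nv \<ge> 1"
begin

text \<open>
  Exponents in this interval already occur in one of the first \<open>l\<close> rows.
\<close>

lemma bordered_minor_eq_0:
  assumes "x \<in> {- int (index_count nv 2 l) ..< int (index_count nv 1 l)}"
  shows "bordered_minor m nv l x = 0"
proof -
  have "x \<in> chi_exp nv ` {..<l}" using assms chi_exp_interval(1)[OF nv, of l] by simp
  then obtain i where "i < l" "x = chi_exp nv i" by auto
  then show ?thesis unfolding bordered_minor_def by (intro minor_repeated_row[of i]) auto
qed

lemma bordered_minor_chi_exp_eq_0: "k < l \<Longrightarrow> bordered_minor m nv l (chi_exp nv k) = 0"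
  using chi_exp_interval(1)[OF nv, of l] by (intro bordered_minor_eq_0) auto

text \<open>
  The core of the theorem. If \<open>m'\<close> are the moments of the measure divided by \<open>1 - w u\<^sup>s\<close> with
  \<open>s = side a\<close>, then \<open>m' k - w m' (k + s) = m k\<close>. Subtracting \<open>w\<close> times the neighbouring row therefore
  turns all rows but the last into unshifted moments, and the last row is a geometric series in \<open>w\<close>.
\<close>

lemma minor_geometric_expansion:
  assumes a: "a = 1 \<or> a = 2"
    and m': "\<And>k. (\<lambda>n. w ^ n * m (k + side a * int n)) sums m' k"
  shows "(\<lambda>n. w ^ n * bordered_minor m nv l (edge_exp nv a l + side a * int n)) sums
    minor (Suc l) (\<lambda>i j. m' ((if i = l then edge_exp nv a l else chi_exp nv i) - chi_exp nv j))"
proof -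
  define p where "p = (\<lambda>i. if i = l then edge_exp nv a l else chi_exp nv i)"
  have succ: "inj_on p {..l}" "\<And>i. i < l \<Longrightarrow> \<exists>k\<le>l. p k = p i + side a"
    unfolding p_def by (fact edge_exp_successor[OF nv a, where l = l])+
  have rec: "m' k - w * m' (k + side a) = m k" for k
  proof -
    have "(\<lambda>n. w ^ Suc n * m (k + side a * int (Suc n))) sums (w * m' (k + side a))"
      using sums_mult[OF m'[of "k + side a"], of w] by (simp add: algebra_simps)
    then have "m' k = w * m' (k + side a) + m k"
      using sums_Suc[of "\<lambda>n. w ^ n * m (k + side a * int n)"] sums_unique2[OF m'[of k]] by simp
    then show ?thesis by simp
  qed
  obtain c where c: "\<And>x. bordered_minor m nv l x = (\<Sum>j\<le>l. c j * m (x - chi_exp nv j))"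
    "\<And>y. minor (Suc l) (\<lambda>i j. if i = l then y j else m (chi_exp nv i - chi_exp nv j)) =
      (\<Sum>j\<le>l. c j * y j)"
    using bordered_minor_linear by blast
  have "minor (Suc l) (\<lambda>i j. m' (p i - chi_exp nv j)) = minor (Suc l)
      (\<lambda>i j. if i = l then m' (p l - chi_exp nv j)
        else m' (p i - chi_exp nv j) - w * m' (p i + side a - chi_exp nv j))"
    by (rule minor_row_operation[where f = "\<lambda>x j. m' (x - chi_exp nv j)", OF succ(1) _ succ(2)])
       (simp add: side_def)
  also have "\<dots> = minor (Suc l) (\<lambda>i j. if i = l then m' (p l - chi_exp nv j)
      else m (chi_exp nv i - chi_exp nv j))"
  proof (rule minor_cong)
    fix i j
    show "(if i = l then m' (p l - chi_exp nv j)
          else m' (p i - chi_exp nv j) - w * m' (p i + side a - chi_exp nv j)) =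
        (if i = l then m' (p l - chi_exp nv j) else m (chi_exp nv i - chi_exp nv j))"
      using rec[of "chi_exp nv i - chi_exp nv j"] by (auto simp: p_def algebra_simps)
  qed
  also have "\<dots> = (\<Sum>j\<le>l. c j * m' (p l - chi_exp nv j))" by (rule c(2))
  finally have minor_eq: "minor (Suc l) (\<lambda>i j. m' (p i - chi_exp nv j)) =
      (\<Sum>j\<le>l. c j * m' (p l - chi_exp nv j))" .
  have "(\<lambda>n. \<Sum>j\<le>l. c j * (w ^ n * m (p l - chi_exp nv j + side a * int n))) sums
      (\<Sum>j\<le>l. c j * m' (p l - chi_exp nv j))"
    by (intro sums_sum sums_mult m')
  also have "(\<lambda>n. \<Sum>j\<le>l. c j * (w ^ n * m (p l - chi_exp nv j + side a * int n))) =
      (\<lambda>n. w ^ n * bordered_minor m nv l (p l + side a * int n))"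
    by (simp add: c(1) sum_distrib_left algebra_simps)
  finally show ?thesis unfolding minor_eq[symmetric] by (simp add: p_def)
qed

text \<open>
  The components of the second kind functions are sums over all \<open>k\<close>. Terms with \<open>k < l\<close> vanish because of
  two equal rows and terms on the other side because of \<open>\<phi>\<close>; what remains is the power series of
  the preceding expansion up to a monomial.
\<close>

lemma sums_over_later_indices:
  assumes a: "a = 1 \<or> a = 2"
    and T: "(\<lambda>n. w ^ n * bordered_minor m nv l (edge_exp nv a l + side a * int n)) sums T"
    and zero: "\<And>k. ind_a nv k \<noteq> a \<Longrightarrow> \<phi> k = 0"
    and \<phi>: "\<And>k n. ind_a nv k = a \<Longrightarrow> index_count nv a k = index_count nv a l + n \<Longrightarrow> \<phi> k = c * w ^ n"
  shows "(\<lambda>k. bordered_minor m nv l (chi_exp nv k) * \<phi> k) sums (c * T)"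
proof -
  obtain \<kappa> where \<kappa>: "strict_mono \<kappa>" "range \<kappa> = {k. l \<le> k \<and> ind_a nv k = a}"
      "\<kappa> 0 = next_ind nv a l"
      "\<And>n. index_count nv a (\<kappa> n) = index_count nv a l + n"
      "\<And>n. chi_exp nv (\<kappa> n) = edge_exp nv a l + side a * int n"
    by (rule later_indices[OF nv a, of l]) (rule that)
  let ?F = "\<lambda>k. bordered_minor m nv l (chi_exp nv k) * \<phi> k"
  have "?F k = 0" if "k \<notin> range \<kappa>" for k
    using that \<kappa>(2) zero bordered_minor_chi_exp_eq_0[of k l m] by (cases "k < l") auto
  then have "?F sums (c * T) \<longleftrightarrow> (\<lambda>n. ?F (\<kappa> n)) sums (c * T)"
    by (rule sums_mono_reindex[OF \<kappa>(1), symmetric])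
  also have "(\<lambda>n. ?F (\<kappa> n)) =
      (\<lambda>n. c * (w ^ n * bordered_minor m nv l (edge_exp nv a l + side a * int n)))"
  proof
    fix n
    have "ind_a nv (\<kappa> n) = a" using \<kappa>(2) by blast
    then show "?F (\<kappa> n) = c * (w ^ n * bordered_minor m nv l (edge_exp nv a l + side a * int n))"
      using \<phi>[OF _ \<kappa>(4)] by (simp add: \<kappa>(5))
  qed
  finally show ?thesis using sums_mult[OF T, of c] by simp
qed

lemma nu_next_ind:
  "nu_plus nv (next_ind nv 1 l) = Suc (index_count nv 1 l)"
  "nu_minus nv (next_ind nv 2 l) = Suc (index_count nv 2 l)"
  "a = 1 \<or> a = 2 \<Longrightarrow> chi_exp nv (next_ind nv a l) = edge_exp nv a l"
proof -
  have *: "ind_a nv (next_ind nv a l) = a \<and> index_count nv a (next_ind nv a l) = index_count nv a l \<and>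
      chi_exp nv (next_ind nv a l) = edge_exp nv a l" if a: "a = 1 \<or> a = 2" for a
  proof -
    obtain \<kappa> where \<kappa>: "strict_mono \<kappa>" "range \<kappa> = {k. l \<le> k \<and> ind_a nv k = a}"
      "\<kappa> 0 = next_ind nv a l"
      "\<And>n. index_count nv a (\<kappa> n) = index_count nv a l + n"
      "\<And>n. chi_exp nv (\<kappa> n) = edge_exp nv a l + side a * int n"
    by (rule later_indices[OF nv a, of l]) (rule that)
    have "\<kappa> 0 \<in> {k. l \<le> k \<and> ind_a nv k = a}" using \<kappa>(2) by blast
    then show ?thesis using \<kappa>(3) \<kappa>(4)[of 0] \<kappa>(5)[of 0] by simp
  qed
  show "nu_plus nv (next_ind nv 1 l) = Suc (index_count nv 1 l)"
    "nu_minus nv (next_ind nv 2 l) = Suc (index_count nv 2 l)"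
    using *[of 1] *[of 2] by (simp_all add: nu_plus_eq nu_minus_eq index_count_Suc)
  show "a = 1 \<or> a = 2 \<Longrightarrow> chi_exp nv (next_ind nv a l) = edge_exp nv a l" using * by blast
qed

lemma chi1_star_at_later_index:
  assumes "z \<noteq> 0" "ind_a nv k = 1" "index_count nv 1 k = index_count nv 1 l + n"
  shows "chi1_star nv z k = z powi (- int (nu_plus nv (next_ind nv 1 l))) * inverse z ^ n"
proof -
  have "chi1_star nv z k = z powi (- 1) * z powi (- int (index_count nv 1 k))"
    using assms(2) by (simp add: chi1_star_def chi1_def nu_plus_eq index_count_Suc
        power_int_minus power_int_inverse power_inverse)
  also have "\<dots> = z powi (- 1 + - int (index_count nv 1 k))"
    by (rule power_int_add[symmetric]) (simp add: assms(1))
  also have "\<dots> = z powi (- int (nu_plus nv (next_ind nv 1 l)) + - int n)"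
    by (rule arg_cong[of _ _ "(powi) z"]) (simp add: assms(3) nu_next_ind(1))
  also have "\<dots> = z powi (- int (nu_plus nv (next_ind nv 1 l))) * inverse z ^ n"
    by (simp only: power_int_add[OF disjI1[OF assms(1)]] power_int_minus power_int_of_nat power_inverse)
  finally show ?thesis .
qed

lemma chi2_at_later_index:
  assumes "ind_a nv k = 2" "index_count nv 2 k = index_count nv 2 l + n"
  shows "chi2 nv z k = z powi (int (nu_minus nv (next_ind nv 2 l)) - 1) * z ^ n"
proof -
  have "chi2 nv z k = z powi int (index_count nv 2 l + n)"
    using assms by (simp add: chi2_def nu_minus_eq index_count_Suc)
  also have "\<dots> = z powi int (index_count nv 2 l) * z ^ n"
    by (simp only: power_int_of_nat power_add)
  finally show ?thesis by (simp add: nu_next_ind(2))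
qed

text \<open>
  Summing the bordered determinants against a two-sided geometric sequence replaces the last row by
  multiples of \<open>y\<^sup>-\<^sup>e\<close>; the terms that are missing on the right-hand side are those with two equal rows.
\<close>

lemma two_sided_bordered_sum:
  assumes y: "y \<noteq> 0" and \<Phi>: "((\<lambda>k. y powi (- k) * m k) has_sum \<Phi>) UNIV"
    and a: "ind_a nv l = a"
    and T1: "(\<lambda>n. inverse y ^ n * bordered_minor m nv l (edge_exp nv 1 l + side 1 * int n)) sums T1"
    and T2: "(\<lambda>n. y ^ n * bordered_minor m nv l (edge_exp nv 2 l + side 2 * int n)) sums T2"
  shows "\<Phi> * (y powi (- edge_exp nv a l) *
      minor l (\<lambda>i j. m (chi_exp nv i - chi_exp nv j)
        - y powi side a * m (chi_exp nv i - chi_exp nv j - side a))) =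
    y powi (- edge_exp nv 1 l) * T1 + y powi (- edge_exp nv 2 l) * T2"
proof -
  let ?e = "chi_exp nv" and ?D = "bordered_minor m nv l"
  let ?p = "int (index_count nv 1 l)" and ?q = "int (index_count nv 2 l)"
  have a12: "a = 1 \<or> a = 2" using a ind_a_cases[of nv l] by auto
  obtain c where c: "\<And>x. ?D x = (\<Sum>j\<le>l. c j * m (x - ?e j))"
    "\<And>z. minor (Suc l) (\<lambda>i j. if i = l then z j else m (?e i - ?e j)) = (\<Sum>j\<le>l. c j * z j)"
    using bordered_minor_linear by blast
  have "((\<lambda>k. y powi (- k) * m (k - x)) has_sum (y powi (- x) * \<Phi>)) UNIV" for x
  proof -
    have "((\<lambda>k. y powi (- x) * (y powi (- k) * m k)) has_sum (y powi (- x) * \<Phi>)) UNIV"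
      by (rule has_sum_cmult_right[OF \<Phi>])
    moreover have "((\<lambda>k. y powi (- x) * (y powi (- k) * m k)) has_sum (y powi (- x) * \<Phi>)) UNIV \<longleftrightarrow>
        ((\<lambda>k. y powi (- k) * m (k - x)) has_sum (y powi (- x) * \<Phi>)) UNIV"
      by (rule has_sum_reindex_bij_witness[of _ "\<lambda>k. k - x" "\<lambda>k. k + x"])
         (use y in \<open>auto simp: power_int_add[symmetric] algebra_simps\<close>)
    ultimately show ?thesis by blast
  qed
  then have "((\<lambda>k. \<Sum>j\<le>l. c j * (y powi (- k) * m (k - ?e j))) has_sum
      (\<Sum>j\<le>l. c j * (y powi (- ?e j) * \<Phi>))) UNIV"
    by (intro has_sum_finite_sum has_sum_cmult_right) auto
  moreover have "(\<lambda>k. \<Sum>j\<le>l. c j * (y powi (- k) * m (k - ?e j))) = (\<lambda>k. y powi (- k) * ?D k)"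
    by (simp add: c(1) sum_distrib_left mult_ac)
  moreover have "(\<Sum>j\<le>l. c j * (y powi (- ?e j) * \<Phi>)) = \<Phi> * (\<Sum>j\<le>l. c j * y powi (- ?e j))"
    by (simp add: sum_distrib_left mult_ac)
  ultimately have total: "((\<lambda>k. y powi (- k) * ?D k) has_sum \<Phi> * (\<Sum>j\<le>l. c j * y powi (- ?e j))) UNIV"
    by simp
  have "(\<Sum>j\<le>l. c j * y powi (- ?e j)) = y powi (- edge_exp nv a l) *
      minor l (\<lambda>i j. m (?e i - ?e j) - y powi side a * m (?e i - ?e j - side a))"
  proof -
    have el: "?e l = edge_exp nv a l" using chi_exp_eq_edge_exp[OF nv, of l] a by simp
    have p: "(if k = l then edge_exp nv a l else ?e k) = ?e k" for k using el by simp
    note succ = edge_exp_successor[OF nv a12, where l = l, unfolded p]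
    define f where "f x i = (if i = l then y powi (- x) else m (?e i - x))" for x and i :: nat
    have "(\<Sum>j\<le>l. c j * y powi (- ?e j)) =
        minor (Suc l) (\<lambda>i j. if i = l then y powi (- ?e j) else m (?e i - ?e j))"
      by (rule c(2)[symmetric])
    also have "\<dots> = minor (Suc l) (\<lambda>i j. f (?e j) i)"
      by (simp add: f_def)
    also have "\<dots> = minor (Suc l) (\<lambda>j i. f (?e j) i)" by (rule minor_transpose)
    \<comment> \<open>Subtracting \<open>y\<^sup>s\<close> times the neighbouring column clears the entries \<open>y\<^sup>-\<^sup>e\<close> of the last row except
        for the last one.\<close>
    also have "\<dots> = minor (Suc l) (\<lambda>j i. if j = l then f (?e l) i
        else f (?e j) i - y powi side a * f (?e j + side a) i)"
      by (rule minor_row_operation[OF succ(1) _ succ(2)]) (simp add: side_def)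
    also have "\<dots> = minor (Suc l) (\<lambda>i j. if j = l then f (?e l) i
        else f (?e j) i - y powi side a * f (?e j + side a) i)" by (rule minor_transpose[symmetric])
    also have "\<dots> = minor (Suc l) (\<lambda>i j. if i = l then (if j = l then y powi (- ?e l) else 0)
        else (if j = l then m (?e i - ?e l)
          else m (?e i - ?e j) - y powi side a * m (?e i - ?e j - side a)))"
    proof (rule minor_cong)
      fix i j
      have "y powi side a * y powi (- (?e j + side a)) = y powi (- ?e j)"
        using y by (simp add: power_int_add[symmetric])
      then show "(if j = l then f (?e l) i else f (?e j) i - y powi side a * f (?e j + side a) i) =
          (if i = l then (if j = l then y powi (- ?e l) else 0)
           else (if j = l then m (?e i - ?e l)
             else m (?e i - ?e j) - y powi side a * m (?e i - ?e j - side a)))"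
        by (auto simp: f_def algebra_simps)
    qed
    also have "\<dots> = y powi (- ?e l) *
        minor l (\<lambda>i j. m (?e i - ?e j) - y powi side a * m (?e i - ?e j - side a))"
    proof -
      let ?A = "Matrix.mat (Suc l) (Suc l) (\<lambda>(i, j). if i = l then (if j = l then y powi (- ?e l) else 0)
        else (if j = l then m (?e i - ?e l)
          else m (?e i - ?e j) - y powi side a * m (?e i - ?e j - side a)))"
      have "Determinant.det ?A = (\<Sum>j<Suc l. ?A $$ (l, j) * cofactor ?A l j)"
        by (rule laplace_expansion_row) auto
      also have "\<dots> = (\<Sum>j<Suc l. if j = l then y powi (- ?e l) * cofactor ?A l l else 0)"
        by (rule sum.cong) auto
      also have "\<dots> = y powi (- ?e l) * cofactor ?A l l" by simp
      also have "cofactor ?A l l = Determinant.det (mat_delete ?A l l)"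
        by (simp add: cofactor_def)
      also have "mat_delete ?A l l = Matrix.mat l l
          (\<lambda>(i, j). m (?e i - ?e j) - y powi side a * m (?e i - ?e j - side a))"
        unfolding mat_delete_def by (rule eq_matI) auto
      finally show ?thesis .
    qed
    finally show ?thesis by (simp add: el)
  qed
  then have total': "((\<lambda>k. y powi (- k) * ?D k) has_sum \<Phi> * (y powi (- edge_exp nv a l) *
      minor l (\<lambda>i j. m (?e i - ?e j) - y powi side a * m (?e i - ?e j - side a)))) UNIV"
    using total by simp
  let ?F = "\<lambda>k. y powi (- k) * ?D k"
  have abs: "(\<lambda>k. norm (?F k)) summable_on A" for A
    using summable_on_subset_banach[OF has_sum_imp_summable[OF total], of A]
    by (simp only: summable_on_iff_abs_summable_on_complex subset_UNIV)
  have half: "(?F has_sum (y powi (- x) * T)) (range (\<lambda>n::nat. x + s * int n))"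
    if s: "s = 1 \<or> s = - 1" and T: "(\<lambda>n. (y powi (- s)) ^ n * ?D (x + s * int n)) sums T" for x s T
  proof -
    have inj: "inj (\<lambda>n::nat. x + s * int n)" using s by (auto intro: injI)
    have eq: "(\<lambda>n. ?F (x + s * int n)) = (\<lambda>n. y powi (- x) * ((y powi (- s)) ^ n * ?D (x + s * int n)))"
    proof
      fix n
      have "y powi (- (x + s * int n)) = y powi (- x) * y powi ((- s) * int n)"
        using y by (simp add: power_int_add[symmetric])
      also have "y powi ((- s) * int n) = (y powi (- s)) ^ n" by (simp only: power_int_mult power_int_of_nat)
      finally show "?F (x + s * int n) = y powi (- x) * ((y powi (- s)) ^ n * ?D (x + s * int n))"
        by simp
    qed
    have "summable (\<lambda>n. norm (?F (x + s * int n)))"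
      using abs[of "range (\<lambda>n::nat. x + s * int n)"] summable_on_reindex[OF inj, of "\<lambda>k. norm (?F k)"]
      by (intro summable_on_imp_summable) (simp add: o_def)
    moreover have "(\<lambda>n. ?F (x + s * int n)) sums (y powi (- x) * T)"
      unfolding eq by (rule sums_mult[OF T])
    ultimately have "((\<lambda>n. ?F (x + s * int n)) has_sum (y powi (- x) * T)) UNIV"
      by (rule norm_summable_imp_has_sum)
    then show ?thesis using has_sum_reindex[OF inj, of ?F] by (simp add: o_def)
  qed
  let ?A = "range (\<lambda>n::nat. edge_exp nv 1 l + 1 * int n)"
  let ?B = "range (\<lambda>n::nat. edge_exp nv 2 l + - 1 * int n)"
  have e12: "edge_exp nv 1 l = ?p" "edge_exp nv 2 l = - ?q - 1" by (simp_all add: edge_exp_def)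
  have A: "?A = {?p..}"
  proof (intro equalityI subsetI)
    fix k assume "k \<in> {?p..}"
    then show "k \<in> ?A" by (intro image_eqI[of _ _ "nat (k - ?p)"]) (unfold e12, auto)
  qed (unfold e12, auto)
  have B: "?B = {..- ?q - 1}"
  proof (intro equalityI subsetI)
    fix k assume "k \<in> {..- ?q - 1}"
    then show "k \<in> ?B" by (intro image_eqI[of _ _ "nat (- ?q - 1 - k)"]) (unfold e12, auto)
  qed (unfold e12, auto)
  have "(?F has_sum (y powi (- edge_exp nv 1 l) * T1)) ?A"
    by (rule half) (use T1 y in \<open>simp_all add: side_def power_int_minus\<close>)
  moreover have "(?F has_sum (y powi (- edge_exp nv 2 l) * T2)) ?B"
    by (rule half) (use T2 in \<open>simp_all add: side_def\<close>)
  ultimately have "(?F has_sum (y powi (- edge_exp nv 1 l) * T1 + y powi (- edge_exp nv 2 l) * T2)) (?A \<union> ?B)"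
    by (rule has_sum_Un_disjoint) (unfold A B, auto)
  moreover have "(?F has_sum (y powi (- edge_exp nv 1 l) * T1 + y powi (- edge_exp nv 2 l) * T2)) (?A \<union> ?B) \<longleftrightarrow>
      (?F has_sum (y powi (- edge_exp nv 1 l) * T1 + y powi (- edge_exp nv 2 l) * T2)) UNIV"
  proof (rule has_sum_cong_neutral)
    fix k assume "k \<in> UNIV - (?A \<union> ?B)"
    then have "k \<in> {- ?q ..< ?p}" unfolding A B by auto
    then show "?F k = 0" by (simp add: bordered_minor_eq_0)
  qed auto
  ultimately show ?thesis using has_sum_unique[OF total'] by blast
qed

end

section \<open>The tau functions as moment determinants\<close>

lemma index_count_add: "index_count nv 1 l + index_count nv 2 l = l"
  by (induction l) (use ind_a_cases[of nv] in \<open>force simp: index_count_Suc\<close>)+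

lemma moment_matrix_eq:
  assumes M: "circle_measure M"
  shows "moment_matrix M nv t i j = moment M t (chi_exp nv i - chi_exp nv j)"
  unfolding moment_matrix_def circle_integral_def circle_moment_def chi_def
proof (rule integral_circle_cong[OF M])
  show "(\<lambda>u. u powi chi_exp nv i * cnj (u powi chi_exp nv j) * exp (potential t u)) \<in> borel_measurable borel"
    by (intro borel_measurable_times borel_measurable_continuous_on[OF continuous_on_cnj[OF continuous_on_id]]) auto
  fix u :: complex assume u: "norm u = 1"
  then have "u \<noteq> 0" by auto
  then have "u powi chi_exp nv i * u powi (- chi_exp nv j) = u powi (chi_exp nv i - chi_exp nv j)"
    by (simp add: power_int_add[symmetric])
  then show "u powi chi_exp nv i * cnj (u powi chi_exp nv j) * exp (potential t u) =
      u powi (chi_exp nv i - chi_exp nv j) * exp (potential t u)"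
    by (simp only: unit_cnj_powi[OF u])
qed auto

lemma holomorphic_minor:
  assumes "\<And>i j. (\<lambda>w. f w i j) holomorphic_on S"
  shows "(\<lambda>w. minor n (f w)) holomorphic_on S"
proof -
  have "minor n (f w) = (\<Sum>p\<in>{p. p permutes {0..<n}}. signof p * (\<Prod>i = 0..<n. f w i (p i)))" for w
  proof -
    have "minor n (f w) = (\<Sum>p\<in>{p. p permutes {0..<n}}. signof p *
        (\<Prod>i = 0..<n. Matrix.mat n n (\<lambda>(i, j). f w i j) $$ (i, p i)))"
      by (rule det_def') simp
    also have "\<dots> = (\<Sum>p\<in>{p. p permutes {0..<n}}. signof p * (\<Prod>i = 0..<n. f w i (p i)))"
      by (intro sum.cong prod.cong arg_cong2[of _ _ _ _ "(*)"] refl)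
         (auto dest: permutes_in_image)
    finally show ?thesis .
  qed
  then show ?thesis by (simp, intro holomorphic_intros assms)
qed

context
  fixes M :: "complex measure" and nv :: "nat \<times> nat"
  assumes M: "circle_measure M" and nv: "fst nv \<ge> 1" "snd nv \<ge> 1"
begin

lemma tau_eq_minor: "tau M nv l t = minor l (\<lambda>i j. moment M t (chi_exp nv i - chi_exp nv j))"
  by (simp add: tau_def moment_matrix_eq[OF M])

lemma tau1_next_eq_minor:
  assumes "a = 1 \<or> a = 2"
  shows "tau1_next M nv a l t = minor (Suc l)
    (\<lambda>i j. moment M t ((if i = l then edge_exp nv a l else chi_exp nv i) - chi_exp nv j))"
  unfolding tau1_next_def moment_matrix_eq[OF M]
  by (rule minor_cong) (simp add: nu_next_ind(3)[OF nv assms])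

lemma tau2_next_eq_minor:
  assumes "a = 1 \<or> a = 2"
  shows "tau2_next M nv a l t = minor (Suc l)
    (\<lambda>i j. moment M t (- ((if i = l then edge_exp nv a l else chi_exp nv i) - chi_exp nv j)))"
  unfolding tau2_next_def moment_matrix_eq[OF M]
  by (subst minor_transpose[symmetric], rule minor_cong) (simp add: nu_next_ind(3)[OF nv assms])

text \<open>
  The first \<open>l\<close> exponents form an interval, so \<open>\<tau>\<^sup>(\<^sup>l\<^sup>)\<close> is a Toeplitz determinant with rows and columns
  permuted in the same way.
\<close>

lemma tau_nonzero:
  assumes "quasi_definite M t"
  shows "tau M nv l t \<noteq> 0"
proof (cases l)
  case 0
  then show ?thesis by (simp add: tau_def det_dim_zero)
next
  case (Suc n)
  define p where "p i = (if i < l then nat (chi_exp nv i + int (index_count nv 2 l)) else i)" for i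
  have e: "- int (index_count nv 2 l) \<le> chi_exp nv i" "chi_exp nv i < int (index_count nv 1 l)"
    if "i < l" for i
    using chi_exp_interval(1)[OF nv, of l] that by auto
  have p: "int (p i) = chi_exp nv i + int (index_count nv 2 l)" if "i < l" for i
    using e[OF that] that by (simp add: p_def)
  have "p permutes {0..<l}"
  proof (rule bij_imp_permutes)
    have inj: "inj_on p {0..<l}"
    proof (rule inj_onI)
      fix i j assume ij: "i \<in> {0..<l}" "j \<in> {0..<l}" "p i = p j"
      then have "chi_exp nv i = chi_exp nv j" using p[of i] p[of j] by simp
      then show "i = j" using inj_onD[OF chi_exp_interval(2)[OF nv, of l]] ij by simp
    qed
    moreover have "p i < l" if "i < l" for i
      using p[OF that] e[OF that] index_count_add[of nv l] by linarith
    then have "p ` {0..<l} \<subseteq> {0..<l}" by auto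
    ultimately show "bij_betw p {0..<l} {0..<l}"
      by (simp add: bij_betw_def endo_inj_surj)
  qed (simp add: p_def)
  from minor_permute[OF this, of "\<lambda>i j. moment M t (int i - int j)"]
  have "minor l (\<lambda>i j. moment M t (int (p i) - int (p j))) = minor l (\<lambda>i j. moment M t (int i - int j))" .
  moreover have "minor l (\<lambda>i j. moment M t (int (p i) - int (p j))) = tau M nv l t"
    unfolding tau_eq_minor by (rule minor_cong) (simp add: p)
  moreover have "minor l (\<lambda>i j. moment M t (int i - int j)) = Determinant.det (toeplitz_moment_matrix M t n)"
    by (simp add: toeplitz_moment_matrix_def Suc circle_integral_def circle_moment_def)
  ultimately show ?thesis using assms by (simp add: quasi_definite_def)
qed

context
  fixes t :: "nat \<Rightarrow> nat \<Rightarrow> complex" and l :: nat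
  assumes t: "entire_parameters t"
begin

text \<open>
  The moments of the image of the deformed measure under \<open>u \<mapsto> 1/u\<close>. Its row determinants are the column
  determinants of the original measure, and the two kinds of Miwa shifts change roles.
\<close>

abbreviation (input) reflected :: "int \<Rightarrow> complex" where
  "reflected \<equiv> \<lambda>k. moment M t (- k)"

text \<open>
  Common form of the next four lemmas: \<open>s\<close> chooses between the moments and their reflection, and \<open>m' w\<close>
  are the moments after the Miwa shift by \<open>w\<close>.
\<close>

lemma continued_tau_next_series:
  assumes a: "a = 1 \<or> a = 2" and s: "s = 1 \<or> s = - 1"
    and f: "\<And>w. norm w < 1 \<Longrightarrow> f w = minor (Suc l)
      (\<lambda>i j. m' w ((if i = l then edge_exp nv a l else chi_exp nv i) - chi_exp nv j))"
    and m': "\<And>w k. norm w < 1 \<Longrightarrow> (\<lambda>n. w ^ n * m (k + side a * int n)) sums m' w k"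
    and m: "\<And>k. m k = moment M t (s * k)"
    and w: "ereal (norm w) < inverse (R_minus M)"
  shows "(\<lambda>n. w ^ n * bordered_minor m nv l (edge_exp nv a l + side a * int n)) sums
    continued f (eball 0 (inverse (R_minus M))) w"
proof (rule continued_power_series[OF _ _ w])
  fix x :: complex assume "norm x < 1"
  then show "(\<lambda>n. x ^ n * bordered_minor m nv l (edge_exp nv a l + side a * int n)) sums f x"
    unfolding f[OF \<open>norm x < 1\<close>] by (intro minor_geometric_expansion[OF nv a] m')
next
  fix x :: complex assume x: "ereal (norm x) < inverse (R_minus M)"
  show "summable (\<lambda>n. x ^ n * bordered_minor m nv l (edge_exp nv a l + side a * int n))"
  proof (rule bordered_minor_summable)
    fix c
    have "summable (\<lambda>n. norm (moment M t (s * c + s * side a * int n)) * norm x ^ n)"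
      by (rule moment_series_summable[OF M t]) (use x s in \<open>auto simp: side_def\<close>)
    then show "summable (\<lambda>n. norm (m (c + side a * int n)) * norm x ^ n)"
      by (simp add: m algebra_simps)
  qed
qed

lemma at_plus1_tau1:
  assumes "ereal (norm w) < inverse (R_minus M)"
  shows "(\<lambda>n. w ^ n * bordered_minor (moment M t) nv l (edge_exp nv 1 l + side 1 * int n)) sums
    at_plus1 M (tau1_next M nv 1 l) t w"
  unfolding at_plus1_def
  by (rule continued_tau_next_series[where s = 1 and m' = "\<lambda>w. moment M (miwa_plus t 1 w)"])
     (use assms moment_miwa(1)[OF M t] tau1_next_eq_minor[of 1] in \<open>auto simp: side_def\<close>)

lemma at_minus2_tau1:
  assumes "ereal (norm w) < inverse (R_minus M)"
  shows "(\<lambda>n. w ^ n * bordered_minor (moment M t) nv l (edge_exp nv 2 l + side 2 * int n)) sums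
    at_minus2 M (tau1_next M nv 2 l) t w"
  unfolding at_minus2_def R_plus_eq[OF M]
  by (rule continued_tau_next_series[where s = 1 and m' = "\<lambda>w. moment M (miwa_minus t 2 w)"])
     (use assms moment_miwa(2)[OF M t] tau1_next_eq_minor[of 2] in \<open>auto simp: side_def\<close>)

lemma at_minus2_tau2:
  assumes "ereal (norm w) < inverse (R_minus M)"
  shows "(\<lambda>n. w ^ n * bordered_minor reflected nv l (edge_exp nv 1 l + side 1 * int n)) sums
    at_minus2 M (tau2_next M nv 1 l) t w"
  unfolding at_minus2_def R_plus_eq[OF M]
  by (rule continued_tau_next_series[where s = "- 1" and m' = "\<lambda>w k. moment M (miwa_minus t 2 w) (- k)"])
     (use assms moment_miwa(2)[OF M t, of _ "- k" for k] tau2_next_eq_minor[of 1] in \<open>auto simp: side_def\<close>)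

lemma at_plus1_tau2:
  assumes "ereal (norm w) < inverse (R_minus M)"
  shows "(\<lambda>n. w ^ n * bordered_minor reflected nv l (edge_exp nv 2 l + side 2 * int n)) sums
    at_plus1 M (tau2_next M nv 2 l) t w"
  unfolding at_plus1_def
  by (rule continued_tau_next_series[where s = "- 1" and m' = "\<lambda>w k. moment M (miwa_plus t 1 w) (- k)"])
     (use assms moment_miwa(1)[OF M t, of _ "- k" for k] tau2_next_eq_minor[of 2] in \<open>auto simp: side_def\<close>)

text \<open>
  The two remaining shifts multiply the measure by a linear factor, so their continuations are
  polynomials in \<open>w\<close>.
\<close>

lemma at_minus1_tau:
  "at_minus1 (tau M nv l) t w = minor l (\<lambda>i j. moment M t (chi_exp nv i - chi_exp nv j)
     - w * moment M t (chi_exp nv i - chi_exp nv j + 1))"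
  unfolding at_minus1_def
proof (rule continued_entire)
  show "(\<lambda>w. minor l (\<lambda>i j. moment M t (chi_exp nv i - chi_exp nv j)
     - w * moment M t (chi_exp nv i - chi_exp nv j + 1))) holomorphic_on UNIV"
    by (intro holomorphic_minor holomorphic_intros)
qed (simp only: tau_eq_minor moment_miwa(3)[OF M t])

lemma at_plus2_tau:
  "at_plus2 (tau M nv l) t w = minor l (\<lambda>i j. moment M t (chi_exp nv i - chi_exp nv j)
     - w * moment M t (chi_exp nv i - chi_exp nv j + - 1))"
  unfolding at_plus2_def
proof (rule continued_entire)
  show "(\<lambda>w. minor l (\<lambda>i j. moment M t (chi_exp nv i - chi_exp nv j)
     - w * moment M t (chi_exp nv i - chi_exp nv j + - 1))) holomorphic_on UNIV"
    by (intro holomorphic_minor holomorphic_intros)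
qed (simp only: tau_eq_minor moment_miwa(4)[OF M t])

section \<open>Second kind functions\<close>

context
  assumes qd: "quasi_definite M t"
begin

lemma gauss_borel_moment_entries:
  "lower_inverse (S1 M nv t) k l = bordered_minor (moment M t) nv l (chi_exp nv k) / tau M nv (l + 1) t"
  "S2 M nv t l k = bordered_minor reflected nv l (chi_exp nv k) / tau M nv l t"
proof -
  let ?g = "moment_matrix M nv t"
  have tau: "minor n ?g = tau M nv n t" for n by (simp add: tau_def)
  then have nz: "minor n ?g \<noteq> 0" for n using tau_nonzero[OF qd] by simp
  have "minor (Suc l) (\<lambda>i j. ?g (if i = l then k else i) j) =
      bordered_minor (moment M t) nv l (chi_exp nv k)"
    unfolding bordered_minor_def by (rule minor_cong) (simp add: moment_matrix_eq[OF M])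
  then show "lower_inverse (S1 M nv t) k l =
      bordered_minor (moment M t) nv l (chi_exp nv k) / tau M nv (l + 1) t"
    using gauss_borel_entries(1)[OF nz, of k l] by (simp add: S1_def tau Suc_eq_plus1[symmetric])
  have "minor (Suc l) (\<lambda>i j. ?g i (if j = l then k else j)) =
      bordered_minor reflected nv l (chi_exp nv k)"
    unfolding bordered_minor_def
    by (subst minor_transpose[symmetric], rule minor_cong) (simp add: moment_matrix_eq[OF M])
  then show "S2 M nv t l k = bordered_minor reflected nv l (chi_exp nv k) / tau M nv l t"
    using gauss_borel_entries(2)[OF nz, of l k] by (simp add: S2_def tau)
qed

lemma C11_sums:
  assumes "R_minus M < ereal (norm z)"
  shows "C11_term M nv t z l sums cnj (cnj z powi (- int (nu_plus nv (next_ind nv 1 l)))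
    * (at_plus1 M (tau1_next M nv 1 l) t (inverse (cnj z)) / tau M nv (l + 1) t))"
proof -
  have z: "z \<noteq> 0" using inverse_radius(1)[OF M assms] by simp
  have "ereal (norm (inverse (cnj z))) < inverse (R_minus M)"
    using inverse_radius(2)[OF M assms] by (simp add: norm_inverse)
  note T = at_plus1_tau1[OF this]
  have "(\<lambda>k. bordered_minor (moment M t) nv l (chi_exp nv k) * chi1_star nv (cnj z) k) sums
      (cnj z powi (- int (nu_plus nv (next_ind nv 1 l))) * at_plus1 M (tau1_next M nv 1 l) t (inverse (cnj z)))"
    by (rule sums_over_later_indices[OF nv _ T])
       (use z chi1_star_at_later_index[OF nv, where z = "cnj z"] in \<open>auto simp: chi1_star_def chi1_def\<close>)
  from sums_cnj[THEN iffD2, OF sums_divide[OF this, of "tau M nv (l + 1) t"]]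
  show ?thesis
    by (simp add: C11_term_def[abs_def] smat_adjoint_def gauss_borel_moment_entries chi1_star_cnj mult_ac)
qed

lemma C12_sums:
  assumes "ereal (norm z) < R_plus M"
  shows "C12_term M nv t z l sums cnj (cnj z powi (int (nu_minus nv (next_ind nv 2 l)) - 1)
    * (at_minus2 M (tau1_next M nv 2 l) t (cnj z) / tau M nv (l + 1) t))"
proof -
  have "ereal (norm (cnj z)) < inverse (R_minus M)" using assms by (simp add: R_plus_eq[OF M])
  note T = at_minus2_tau1[OF this]
  have "(\<lambda>k. bordered_minor (moment M t) nv l (chi_exp nv k) * chi2 nv (cnj z) k) sums
      (cnj z powi (int (nu_minus nv (next_ind nv 2 l)) - 1) * at_minus2 M (tau1_next M nv 2 l) t (cnj z))"
    by (rule sums_over_later_indices[OF nv _ T])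
       (use chi2_at_later_index[OF nv, where z = "cnj z"] in \<open>auto simp: chi2_def\<close>)
  from sums_cnj[THEN iffD2, OF sums_divide[OF this, of "tau M nv (l + 1) t"]]
  show ?thesis
    by (simp add: C12_term_def[abs_def] smat_adjoint_def gauss_borel_moment_entries chi2_cnj mult_ac)
qed

lemma C21_sums:
  assumes "inverse (R_plus M) < ereal (norm z)"
  shows "C21_term M nv t z l sums (z powi (- int (nu_plus nv (next_ind nv 1 l)))
    * (at_minus2 M (tau2_next M nv 1 l) t (inverse z) / tau M nv l t))"
proof -
  have R: "R_minus M < ereal (norm z)" using assms by (simp add: inverse_R_plus[OF M])
  have z: "z \<noteq> 0" using inverse_radius(1)[OF M R] by simp
  have "ereal (norm (inverse z)) < inverse (R_minus M)"
    using inverse_radius(2)[OF M R] by (simp add: norm_inverse)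
  note T = at_minus2_tau2[OF this]
  have "(\<lambda>k. bordered_minor reflected nv l (chi_exp nv k) * chi1_star nv z k) sums
      (z powi (- int (nu_plus nv (next_ind nv 1 l))) * at_minus2 M (tau2_next M nv 1 l) t (inverse z))"
    by (rule sums_over_later_indices[OF nv _ T])
       (use z chi1_star_at_later_index[OF nv, where z = z] in \<open>auto simp: chi1_star_def chi1_def\<close>)
  from sums_divide[OF this, of "tau M nv l t"]
  show ?thesis
    by (simp add: C21_term_def[abs_def] gauss_borel_moment_entries)
qed

lemma C22_sums:
  assumes "ereal (norm z) < inverse (R_minus M)"
  shows "C22_term M nv t z l sums (z powi (int (nu_minus nv (next_ind nv 2 l)) - 1)
    * (at_plus1 M (tau2_next M nv 2 l) t z / tau M nv l t))"
proof -
  note T = at_plus1_tau2[OF assms]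
  have "(\<lambda>k. bordered_minor reflected nv l (chi_exp nv k) * chi2 nv z k) sums
      (z powi (int (nu_minus nv (next_ind nv 2 l)) - 1) * at_plus1 M (tau2_next M nv 2 l) t z)"
    by (rule sums_over_later_indices[OF nv _ T])
       (use chi2_at_later_index[OF nv, where z = z] in \<open>auto simp: chi2_def\<close>)
  from sums_divide[OF this, of "tau M nv l t"]
  show ?thesis
    by (simp add: C22_term_def[abs_def] gauss_borel_moment_entries)
qed

end

section \<open>The Fourier series\<close>

context
  fixes z :: complex
  assumes z1: "R_minus M < ereal (norm z)" and z2: "ereal (norm z) < R_plus M"
begin

text \<open>
  The side of \<open>l\<close> decides which linear factor clears the last row, hence which shift of \<open>\<tau>\<close> appears.
\<close>

lemma fourier_series_tau1:
  defines "\<Phi> \<equiv> 2 * of_real pi * fourier_series M t z"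
    and "T1 \<equiv> at_plus1 M (tau1_next M nv 1 l) t (inverse z)"
    and "T2 \<equiv> at_minus2 M (tau1_next M nv 2 l) t z"
  shows "ind_a nv l = 1 \<Longrightarrow> \<Phi> * (z powi (- edge_exp nv 1 l) * at_plus2 (tau M nv l) t z) =
      z powi (- edge_exp nv 1 l) * T1 + z powi (- edge_exp nv 2 l) * T2"
    and "ind_a nv l = 2 \<Longrightarrow> \<Phi> * (z powi (- edge_exp nv 2 l) * at_minus1 (tau M nv l) t (inverse z)) =
      z powi (- edge_exp nv 1 l) * T1 + z powi (- edge_exp nv 2 l) * T2"
proof -
  note sum = two_sided_bordered_sum[OF nv annulus_radii(1)[OF M z1 z2] fourier_series_has_sum(1)[OF M t z1 z2] _
      at_plus1_tau1[OF annulus_radii(2)[OF M z1 z2]] at_minus2_tau1[OF annulus_radii(3)[OF M z1 z2]]]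
  show "ind_a nv l = 1 \<Longrightarrow> \<Phi> * (z powi (- edge_exp nv 1 l) * at_plus2 (tau M nv l) t z) =
      z powi (- edge_exp nv 1 l) * T1 + z powi (- edge_exp nv 2 l) * T2"
    using sum[of 1] by (simp add: \<Phi>_def T1_def T2_def at_plus2_tau side_def)
  show "ind_a nv l = 2 \<Longrightarrow> \<Phi> * (z powi (- edge_exp nv 2 l) * at_minus1 (tau M nv l) t (inverse z)) =
      z powi (- edge_exp nv 1 l) * T1 + z powi (- edge_exp nv 2 l) * T2"
    using sum[of 2] by (simp add: \<Phi>_def T1_def T2_def at_minus1_tau side_def power_int_minus)
qed

lemma fourier_series_tau2:
  defines "\<Phi> \<equiv> 2 * of_real pi * fourier_series M t z"
    and "T1 \<equiv> at_minus2 M (tau2_next M nv 1 l) t z"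
    and "T2 \<equiv> at_plus1 M (tau2_next M nv 2 l) t (inverse z)"
  shows "ind_a nv l = 1 \<Longrightarrow> \<Phi> * (z powi edge_exp nv 1 l * at_minus1 (tau M nv l) t (inverse z)) =
      z powi edge_exp nv 1 l * T1 + z powi edge_exp nv 2 l * T2"
    and "ind_a nv l = 2 \<Longrightarrow> \<Phi> * (z powi edge_exp nv 2 l * at_plus2 (tau M nv l) t z) =
      z powi edge_exp nv 1 l * T1 + z powi edge_exp nv 2 l * T2"
proof -
  have y: "inverse z \<noteq> 0" using annulus_radii(1)[OF M z1 z2] by simp
  have T1: "(\<lambda>n. inverse (inverse z) ^ n * bordered_minor reflected nv l (edge_exp nv 1 l + side 1 * int n)) sums T1"
    using at_minus2_tau2[OF annulus_radii(3)[OF M z1 z2]] by (simp add: T1_def)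
  note sum = two_sided_bordered_sum[OF nv y fourier_series_has_sum(2)[OF M t z1 z2] _ T1 at_plus1_tau2[OF annulus_radii(2)[OF M z1 z2]],
      folded \<Phi>_def T2_def]
  have powi: "inverse z powi (- k) = z powi k" for k by (simp add: power_int_minus power_int_inverse)
  have "at_minus1 (tau M nv l) t (inverse z) = minor l (\<lambda>i j. reflected (chi_exp nv i - chi_exp nv j)
      - inverse z powi side 1 * reflected (chi_exp nv i - chi_exp nv j - side 1))"
    unfolding at_minus1_tau
    by (subst minor_transpose[symmetric], rule minor_cong) (simp add: side_def algebra_simps)
  then show "ind_a nv l = 1 \<Longrightarrow> \<Phi> * (z powi edge_exp nv 1 l * at_minus1 (tau M nv l) t (inverse z)) =
      z powi edge_exp nv 1 l * T1 + z powi edge_exp nv 2 l * T2"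
    using sum[of 1] by (simp only: powi)
  have "at_plus2 (tau M nv l) t z = minor l (\<lambda>i j. reflected (chi_exp nv i - chi_exp nv j)
      - inverse z powi side 2 * reflected (chi_exp nv i - chi_exp nv j - side 2))"
    unfolding at_plus2_tau
    by (subst minor_transpose[symmetric], rule minor_cong)
       (simp add: side_def power_int_minus algebra_simps)
  then show "ind_a nv l = 2 \<Longrightarrow> \<Phi> * (z powi edge_exp nv 2 l * at_plus2 (tau M nv l) t z) =
      z powi edge_exp nv 1 l * T1 + z powi edge_exp nv 2 l * T2"
    using sum[of 2] by (simp only: powi)
qed

end

end

end

lemma solve_two_term_relation:
  fixes z :: complex
  assumes z: "z \<noteq> 0" and "D \<noteq> 0"
    and rel: "c * F * (z powi a * D) = z powi p * T1 + z powi q * T2" and "c \<noteq> 0"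
  shows "F = (z powi (p - a) * T1 + z powi (q - a) * T2) / (c * D)"
proof -
  have nz: "z powi a \<noteq> 0" using z by simp
  have split: "z powi p = z powi a * z powi (p - a)" "z powi q = z powi a * z powi (q - a)"
    using z by (simp_all add: power_int_add[symmetric])
  have "z powi a * (c * F * D) = c * F * (z powi a * D)" by (simp only: mult_ac)
  also have "\<dots> = z powi p * T1 + z powi q * T2" by (rule rel)
  also have "\<dots> = z powi a * (z powi (p - a) * T1 + z powi (q - a) * T2)"
    by (simp only: split distrib_left mult.assoc)
  finally have "c * F * D = z powi (p - a) * T1 + z powi (q - a) * T2"
    by (rule mult_left_cancel[OF nz, THEN iffD1])
  then show ?thesis using assms(2,4) by (simp add: eq_divide_eq mult_ac)
qed

theorem theorem11:
  fixes M :: "complex measure" and t :: "nat \<Rightarrow> nat \<Rightarrow> complex"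
    and nv :: "nat \<times> nat" and l :: nat and N :: int
  assumes "circle_measure M"
    and "entire_parameters t"
    and "quasi_definite M t"
    and "fst nv \<ge> 1" and "snd nv \<ge> 1"
    and "l \<ge> fst nv + snd nv"
    and "N = int (nu_plus nv (next_ind nv 1 l)) + int (nu_minus nv (next_ind nv 2 l)) - 1"
  shows
    "(\<forall>z. R_minus M < ereal (norm z) \<longrightarrow>
        summable (C11_term M nv t z l) \<and>
        cnj (C11 M nv t z l) =
          cnj z powi (- int (nu_plus nv (next_ind nv 1 l)))
          * (at_plus1 M (tau1_next M nv 1 l) t (inverse (cnj z)) / tau M nv (l + 1) t)) \<and>
     (\<forall>z. ereal (norm z) < R_plus M \<longrightarrow>
        summable (C12_term M nv t z l) \<and>
        cnj (C12 M nv t z l) =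
          cnj z powi (int (nu_minus nv (next_ind nv 2 l)) - 1)
          * (at_minus2 M (tau1_next M nv 2 l) t (cnj z) / tau M nv (l + 1) t)) \<and>
     (\<forall>z. R_minus M < ereal (norm z) \<and> ereal (norm z) < R_plus M \<longrightarrow>
        cnj (C1 M nv t z l) =
          (cnj z powi (- int (nu_plus nv (next_ind nv 1 l)))
             * at_plus1 M (tau1_next M nv 1 l) t (inverse (cnj z))
           + cnj z powi (int (nu_minus nv (next_ind nv 2 l)) - 1)
             * at_minus2 M (tau1_next M nv 2 l) t (cnj z))
          / tau M nv (l + 1) t) \<and>
     (\<forall>z. inverse (R_plus M) < ereal (norm z) \<longrightarrow>
        summable (C21_term M nv t z l) \<and>
        C21 M nv t z l =
          z powi (- int (nu_plus nv (next_ind nv 1 l)))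
          * (at_minus2 M (tau2_next M nv 1 l) t (inverse z) / tau M nv l t)) \<and>
     (\<forall>z. ereal (norm z) < inverse (R_minus M) \<longrightarrow>
        summable (C22_term M nv t z l) \<and>
        C22 M nv t z l =
          z powi (int (nu_minus nv (next_ind nv 2 l)) - 1)
          * (at_plus1 M (tau2_next M nv 2 l) t z / tau M nv l t)) \<and>
     (\<forall>z. inverse (R_plus M) < ereal (norm z) \<and> ereal (norm z) < inverse (R_minus M) \<longrightarrow>
        C2 M nv t z l =
          (z powi (- int (nu_plus nv (next_ind nv 1 l)))
             * at_minus2 M (tau2_next M nv 1 l) t (inverse z)
           + z powi (int (nu_minus nv (next_ind nv 2 l)) - 1)
             * at_plus1 M (tau2_next M nv 2 l) t z)
          / tau M nv l t) \<and>
     (\<forall>z. R_minus M < ereal (norm z) \<and> ereal (norm z) < R_plus M \<longrightarrow>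
        (\<lambda>n. fourier_coeff M t n * z powi n) summable_on UNIV) \<and>
     (\<forall>z. R_minus M < ereal (norm z) \<and> ereal (norm z) < R_plus M \<and> ind_a nv l = 1 \<longrightarrow>
        (at_minus1 (tau M nv l) t (inverse z) \<noteq> 0 \<longrightarrow>
           fourier_series M t z =
             (at_minus2 M (tau2_next M nv 1 l) t z
              + z powi (- N) * at_plus1 M (tau2_next M nv 2 l) t (inverse z))
             / (2 * of_real pi * at_minus1 (tau M nv l) t (inverse z))) \<and>
        (at_plus2 (tau M nv l) t z \<noteq> 0 \<longrightarrow>
           fourier_series M t z =
             (at_plus1 M (tau1_next M nv 1 l) t (inverse z)
              + z powi N * at_minus2 M (tau1_next M nv 2 l) t z)
             / (2 * of_real pi * at_plus2 (tau M nv l) t z))) \<and>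
     (\<forall>z. R_minus M < ereal (norm z) \<and> ereal (norm z) < R_plus M \<and> ind_a nv l = 2 \<longrightarrow>
        (at_plus2 (tau M nv l) t z \<noteq> 0 \<longrightarrow>
           fourier_series M t z =
             (z powi N * at_minus2 M (tau2_next M nv 1 l) t z
              + at_plus1 M (tau2_next M nv 2 l) t (inverse z))
             / (2 * of_real pi * at_plus2 (tau M nv l) t z)) \<and>
        (at_minus1 (tau M nv l) t (inverse z) \<noteq> 0 \<longrightarrow>
           fourier_series M t z =
             (z powi (- N) * at_plus1 M (tau1_next M nv 1 l) t (inverse z)
              + at_minus2 M (tau1_next M nv 2 l) t z)
             / (2 * of_real pi * at_minus1 (tau M nv l) t (inverse z))))"
proof -
  note M = assms(1) and t = assms(2) and qd = assms(3) and nv = assms(4,5)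
  let ?np = "int (nu_plus nv (next_ind nv 1 l))" and ?nm = "int (nu_minus nv (next_ind nv 2 l)) - 1"
  note c11 = C11_sums[OF M nv t qd] and c12 = C12_sums[OF M nv t qd]
  note c21 = C21_sums[OF M nv t qd] and c22 = C22_sums[OF M nv t qd]
  have edges: "edge_exp nv 1 l - edge_exp nv 2 l = N"
    using assms(7) by (simp add: edge_exp_def nu_next_ind[OF nv])
  have C11: "summable (C11_term M nv t z l) \<and> cnj (C11 M nv t z l) =
      cnj z powi (- ?np) * (at_plus1 M (tau1_next M nv 1 l) t (inverse (cnj z)) / tau M nv (l + 1) t)"
    if "R_minus M < ereal (norm z)" for z
    using c11[OF that] by (simp add: C11_def sums_iff)
  have C12: "summable (C12_term M nv t z l) \<and> cnj (C12 M nv t z l) =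
      cnj z powi ?nm * (at_minus2 M (tau1_next M nv 2 l) t (cnj z) / tau M nv (l + 1) t)"
    if "ereal (norm z) < R_plus M" for z
    using c12[OF that] by (simp add: C12_def sums_iff)
  have C21: "summable (C21_term M nv t z l) \<and> C21 M nv t z l =
      z powi (- ?np) * (at_minus2 M (tau2_next M nv 1 l) t (inverse z) / tau M nv l t)"
    if "inverse (R_plus M) < ereal (norm z)" for z
    using c21[OF that] by (simp add: C21_def sums_iff)
  have C22: "summable (C22_term M nv t z l) \<and> C22 M nv t z l =
      z powi ?nm * (at_plus1 M (tau2_next M nv 2 l) t z / tau M nv l t)"
    if "ereal (norm z) < inverse (R_minus M)" for z
    using c22[OF that] by (simp add: C22_def sums_iff)
  have C1: "cnj (C1 M nv t z l) =
      (cnj z powi (- ?np) * at_plus1 M (tau1_next M nv 1 l) t (inverse (cnj z))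
        + cnj z powi ?nm * at_minus2 M (tau1_next M nv 2 l) t (cnj z)) / tau M nv (l + 1) t"
    if "R_minus M < ereal (norm z)" "ereal (norm z) < R_plus M" for z
    using C11[OF that(1)] C12[OF that(2)] by (simp add: C1_def add_divide_distrib)
  have C2: "C2 M nv t z l =
      (z powi (- ?np) * at_minus2 M (tau2_next M nv 1 l) t (inverse z)
        + z powi ?nm * at_plus1 M (tau2_next M nv 2 l) t z) / tau M nv l t"
    if "inverse (R_plus M) < ereal (norm z)" "ereal (norm z) < inverse (R_minus M)" for z
    using C21[OF that(1)] C22[OF that(2)] by (simp add: C2_def add_divide_distrib)
  have pi: "2 * of_real pi \<noteq> (0 :: complex)" by simp
  note solve = solve_two_term_relation[OF _ _ _ pi]
  have N: "edge_exp nv 2 l - edge_exp nv 1 l = - N" "- edge_exp nv 2 l - - edge_exp nv 1 l = N"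
    "- edge_exp nv 1 l - - edge_exp nv 2 l = - N"
    using edges by simp_all
  have F1: "(at_minus1 (tau M nv l) t (inverse z) \<noteq> 0 \<longrightarrow> fourier_series M t z =
        (at_minus2 M (tau2_next M nv 1 l) t z
          + z powi (- N) * at_plus1 M (tau2_next M nv 2 l) t (inverse z))
        / (2 * of_real pi * at_minus1 (tau M nv l) t (inverse z))) \<and>
      (at_plus2 (tau M nv l) t z \<noteq> 0 \<longrightarrow> fourier_series M t z =
        (at_plus1 M (tau1_next M nv 1 l) t (inverse z)
          + z powi N * at_minus2 M (tau1_next M nv 2 l) t z)
        / (2 * of_real pi * at_plus2 (tau M nv l) t z))"
    if z: "R_minus M < ereal (norm z)" "ereal (norm z) < R_plus M" and a: "ind_a nv l = 1" for z
  proof -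
    note z0 = annulus_radii(1)[OF M z]
    show ?thesis
      using solve[OF z0 _ fourier_series_tau2(1)[OF M nv t z a]]
        solve[OF z0 _ fourier_series_tau1(1)[OF M nv t z a]]
      unfolding N by simp
  qed
  have F2: "(at_plus2 (tau M nv l) t z \<noteq> 0 \<longrightarrow> fourier_series M t z =
        (z powi N * at_minus2 M (tau2_next M nv 1 l) t z
          + at_plus1 M (tau2_next M nv 2 l) t (inverse z))
        / (2 * of_real pi * at_plus2 (tau M nv l) t z)) \<and>
      (at_minus1 (tau M nv l) t (inverse z) \<noteq> 0 \<longrightarrow> fourier_series M t z =
        (z powi (- N) * at_plus1 M (tau1_next M nv 1 l) t (inverse z)
          + at_minus2 M (tau1_next M nv 2 l) t z)
        / (2 * of_real pi * at_minus1 (tau M nv l) t (inverse z)))"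
    if z: "R_minus M < ereal (norm z)" "ereal (norm z) < R_plus M" and a: "ind_a nv l = 2" for z
  proof -
    note z0 = annulus_radii(1)[OF M z]
    show ?thesis
      using solve[OF z0 _ fourier_series_tau2(2)[OF M nv t z a]]
        solve[OF z0 _ fourier_series_tau1(2)[OF M nv t z a]]
      unfolding edges N by simp
  qed
  show ?thesis
    using C11 C12 C1 C21 C22 C2 fourier_series_summable[OF M t] F1 F2 by blast
qed

end
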